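(* There exists an $\hat H_q$-module structure on $\mathbf W$ such that for each $n\in\{0,1,2,3\}$ the matrix $\mathcal T_n$ represents the generator $t_n$ relative to the basis $\mathcal C$ of $\mathbf W$ (with $\hat H_q$, $\mathbf W$, $\mathcal C$, $\mathcal T_n$ as defined in the context).
   Context: **Graph.** $\Gamma$ is a finite undirected connected graph without loops or multiple edges, with vertex set $X$, path-length distance $\partial$ and diameter $d\ge 3$; $\Gamma_i(y)=\{z\in X:\partial(y,z)=i\}$, $\Gamma(y)=\Gamma_1(y)$. $\Gamma$ is distance-regular: $p^h_{ij}=|\Gamma_i(y)\cap\Gamma_j(z)|$ depends only on $i,j$ and $h=\partial(y,z)$. Put $a_i=p^i_{1,i}$, $b_i=p^i_{1,i+1}$, $c_i=p^i_{1,i-1}$ ($b_d=c_0=0$), $k=b_0$. Complex matrices indexed by $X$ act on $\mathbf V=\mathbb C^X$ with inner product $\langle u,v\rangle=u^t\overline v$; $\hat y$ is the standard basis vector at $y$, $\hat Y=\sum_{y\in Y}\hat y$, $\mathbf j=\hat X$. $A_i$ is the $i$-th distance matrix, $A=A_1$, $\mathcal M$ is the algebra generated by $A$ (Bose–Mesner algebra), with primitive idempotents $E_0=|X|^{-1}J,E_1,\dots,E_d$ ($J$ all-ones) and $A=\sum_i\theta_iE_i$; $m_i=\operatorname{rank}E_i$. $\Gamma$ is $Q$-polynomial with respect to $E_0,\dots,E_d$: writing $E_i\circ E_j=|X|^{-1}\sum_h q^h_{ij}E_h$ (entrywise product), $q^h_{ij}=0$ (resp. $\ne0$) if one of $h,i,j$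 is greater than (resp. equal to) the sum of the other two. It is assumed that $\theta_0>\theta_1>\dots>\theta_d$. **Clique.** $C\subseteq X$ is a Delsarte clique: a nonempty set of mutually adjacent vertices with $|C|=1-k/\theta_d$. Fix $x\in C$. $A^*=A^*(x)$ is the diagonal matrix with $(z,z)$-entry $|X|(E_1)_{xz}$; $E^*_i$ ($0\le i\le d$) is the diagonal projection onto $\mathrm{Span}\{\hat z:\partial(x,z)=i\}$, and $A^*=\sum_i\theta^*_iE^*_i$. For $0\le i\le d-1$, $C_i=\{y\in X:\partial(y,C)=i\}$ (these partition $X$). **Leonard systems.** On a complex vector space $V$ of dimension $n+1$, a Leonard system of diameter $n$ is a sequence $(B;B^*;\{F_i\}_{i=0}^n;\{F^*_i\}_{i=0}^n)$ where $B,B^*\in\mathrm{End}(V)$ each have $n+1$ distinct eigenvalues, $\{F_i\}$ (resp. $\{F_i^*\}$) is an ordering of the primitive idempotents (spectral projections) of $B$ (resp. $B^*$), and $F_iB^*F_j$, $F^*_iBF^*_j$ are $0$ if $|i-j|>1$ and nonzero if $|i-j|=1$. Eigenvalues $\vartheta_i$, dual eigenvalues $\vartheta^*_i$ are defined by $BF_i=\vartheta_iF_i$, $B^*F_i^*=\vartheta_i^*F_i^*$. The first split sequence is the sequence of nonzero scalars $\varphi_1,\dots,\varphi_n$ such that in some basis $B$ is lower bidiagonal with diagonal $\vartheta_0,\dots,\vartheta_n$ and subdiagonal entries $1$, and $B^*$ is upper bidiagonal with diagonal $\vartheta^*_0,\dots,\vartheta_n^*$ and superdiagonal $\varphi_1,\dots,\varphi_n$.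 The second split sequence $\{\phi_i\}$ is the first split sequence of $(B;B^*;\{F_{n-i}\};\{F^*_i\})$. The parameter array is $(\{\vartheta_i\},\{\vartheta_i^*\},\{\varphi_i\},\{\phi_i\})$. **$q$-Racah assumption.** $q\in\mathbb C$ is nonzero, $q^2\neq1$. $(A;A^*;\{E_i\}_{i=0}^d;\{E_i^*\}_{i=0}^d)$ acts on $\mathcal M\hat x$ (of dimension $d+1$) as a Leonard system $\Phi$ with parameter array $(\{\theta_i\},\{\theta^*_i\},\{\varphi_i\},\{\phi_i\})$. $\Gamma$ is assumed to have $q$-Racah type: there are nonzero $h,h^*,s,s^*,r_1,r_2\in\mathbb C$ (fixed) with $r_1r_2=ss^*q^{d+1}$, none of $q^i,r_1q^i,r_2q^i,s^*q^i/r_1,s^*q^i/r_2$ equal to $1$ for $1\le i\le d$, neither of $sq^i,s^*q^i$ equal to $1$ for $2\le i\le 2d$, and $\theta_i=\theta_0+h(1-q^i)(1-sq^{i+1})q^{-i}$, $\theta^*_i=\theta^*_0+h^*(1-q^i)(1-s^*q^{i+1})q^{-i}$ ($0\le i\le d$), $\varphi_i=hh^*q^{1-2i}(1-q^i)(1-q^{i-d-1})(1-r_1q^i)(1-r_2q^i)$, $\phi_i=hh^*q^{1-2i}(1-q^i)(1-q^{i-d-1})(r_1-s^*q^i)(r_2-s^*q^i)/s^*$ ($1\le i\le d$). **The space $\mathbf W$.** For $0\le i\le d-1$, $C_i^-=C_i\cap\Gamma_i(x)$, $C_i^+=C_i\cap\Gamma_{i+1}(x)$; $\mathbf W=\mathrm{Span}\{\hat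 C_i^{\pm}\}_{i=0}^{d-1}$, which has basis $\mathcal C=\{\hat C_0^-,\hat C_0^+,\hat C_1^-,\hat C_1^+,\dots,\hat C_{d-1}^-,\hat C_{d-1}^+\}$ (in this order). **The algebra and the matrices.** Fix a square root $q^{1/2}$ of $q$ and square roots $s^{1/2},s^{*1/2},r_1^{1/2},r_2^{1/2}$ with $r_1^{1/2}r_2^{1/2}=s^{1/2}s^{*1/2}q^{(d+1)/2}$. $\hat H_q$ is the $\mathbb C$-algebra with generators $t_n^{\pm1}$ ($n=0,1,2,3$) and relations $t_nt_n^{-1}=t_n^{-1}t_n=1$; $t_n+t_n^{-1}$ central; $t_0t_1t_2t_3=q^{-1/2}$. Put $\sigma=s^{*1/2}$, $\rho=r_1^{1/2}r_2^{1/2}$, $\kappa=s^{*1/2}q^{(d+1)/2}$. For $0\le i\le d-1$ let $P_i=\frac{(r_1-s^*q^{i+1})(r_2-s^*q^{i+1})}{1-s^*q^{2i+2}}$, $R_i=\frac{(1-r_1q^{i+1})(1-r_2q^{i+1})}{1-s^*q^{2i+2}}$, and for $1\le i\le d-1$ let $U_i=\frac{(1-q^{i-d})(1-s^*q^{i+1})}{1-s^*q^{2i+1}}$, $V_i=\frac{(1-q^i)(1-s^*q^{d+i+1})}{1-s^*q^{2i+1}}$, $Z_i=\frac{(1-q^i)(1-q^{i-d})}{1-s^*q^{2i+1}}$. Define $$\mathfrak t_0(i)=\begin{bmatrix}\frac{P_i+s^*}{\sigma\rho}&-\frac{\sigma}{\rho}R_i\\ \frac{P_i}{\sigma\rho}&\frac{\sigma}{\rho}(1-R_i)\end{bmatrix},\quad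 \mathfrak t_3(i)=\begin{bmatrix}\frac{1-R_i}{q^{i+1}\rho}&\frac{R_i}{q^{i+1}\rho}\\ -\frac{q^{i+1}}{\rho}P_i&\frac{q^{i+1}}{\rho}(P_i+s^* )\end{bmatrix}\quad(0\le i\le d-1),$$ $$\mathfrak t_1(i)=\begin{bmatrix}q^{d/2}U_i+q^{-d/2}&-q^{d/2}U_i\\ q^{-d/2}V_i&q^{-d/2}(1-V_i)\end{bmatrix},\quad \mathfrak t_2(i)=\begin{bmatrix}\frac{\kappa^2Z_i+1}{\kappa}&q^i\kappa U_i\\ -\frac{V_i}{q^i\kappa}&\kappa(1-Z_i)\end{bmatrix}\quad(1\le i\le d-1),$$ and $1\times1$ matrices $\mathfrak t_1(0)=\mathfrak t_1(d)=[q^{-d/2}]$, $\mathfrak t_2(0)=[\kappa]$, $\mathfrak t_2(d)=[\kappa^{-1}]$. For $n\in\{0,3\}$, $\mathcal T_n=\mathrm{blockdiag}[\mathfrak t_n(0),\dots,\mathfrak t_n(d-1)]$; for $n\in\{1,2\}$, $\mathcal T_n=\mathrm{blockdiag}[\mathfrak t_n(0),\mathfrak t_n(1),\dots,\mathfrak t_n(d)]$. A matrix $N$ represents a map $f$ relative to an ordered basis $w_1,\dots,w_{2d}$ when $f(w_j)=\sum_iN_{ij}w_i$. *)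

theory Defs
  imports
    "HOL-Analysis.Analysis"
    "HOL-Algebra.QuotRing"
    "HOL-Library.Poly_Mapping"
    "Jordan_Normal_Form.Matrix"
begin

text \<open>
  Matrices indexed by the vertex set have type \<open>complex^'v^'v\<close>, with product \<open>**\<close>;
  matrices of size depending on the diameter have type \<open>complex mat\<close>, with entries
  \<open>N $$ (i, j)\<close> indexed from 0.
\<close>

no_notation vec_index (infixl \<open>$\<close> 100)
hide_const (open) Matrix.vec Matrix.mat Matrix.row Matrix.unit_vec
hide_type (open) Matrix.vec


section \<open>Graphs\<close>

text \<open>A graph is given by its adjacency relation; the whole type is the vertex set.\<close>

definition simple_connected_graph :: "('v::finite \<Rightarrow> 'v \<Rightarrow> bool) \<Rightarrow> bool" where
  "simple_connected_graph adj \<longleftrightarrow> symp adj \<and> irreflp adj \<and> (\<forall>y z. adj\<^sup>*\<^sup>* y z)"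

definition gdist :: "('v::finite \<Rightarrow> 'v \<Rightarrow> bool) \<Rightarrow> 'v \<Rightarrow> 'v \<Rightarrow> nat" where
  "gdist adj y z = (LEAST n. (adj ^^ n) y z)"

definition diam :: "('v::finite \<Rightarrow> 'v \<Rightarrow> bool) \<Rightarrow> nat" where
  "diam adj = Max {gdist adj y z | y z. True}"

definition sphere_at :: "('v::finite \<Rightarrow> 'v \<Rightarrow> bool) \<Rightarrow> nat \<Rightarrow> 'v \<Rightarrow> 'v set" where
  "sphere_at adj i y = {z. gdist adj y z = i}"

definition distance_regular :: "('v::finite \<Rightarrow> 'v \<Rightarrow> bool) \<Rightarrow> bool" where
  "distance_regular adj \<longleftrightarrow>
     (\<forall>h i j y z y' z'. gdist adj y z = h \<and> gdist adj y' z' = h \<longrightarrow>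
        card (sphere_at adj i y \<inter> sphere_at adj j z)
          = card (sphere_at adj i y' \<inter> sphere_at adj j z'))"

text \<open>The intersection number \<open>p\<^sup>h\<^sub>i\<^sub>j\<close>; meaningful for distance-regular graphs and
  \<open>h\<close> at most the diameter.\<close>

definition intersection_number :: "('v::finite \<Rightarrow> 'v \<Rightarrow> bool) \<Rightarrow> nat \<Rightarrow> nat \<Rightarrow> nat \<Rightarrow> nat" where
  "intersection_number adj h i j =
     (THE n. \<forall>y z. gdist adj y z = h \<longrightarrow> card (sphere_at adj i y \<inter> sphere_at adj j z) = n)"

definition valency :: "('v::finite \<Rightarrow> 'v \<Rightarrow> bool) \<Rightarrow> nat" where
  "valency adj = intersection_number adj 0 1 1"

definition distance_matrix :: "('v::finite \<Rightarrow> 'v \<Rightarrow> bool) \<Rightarrow> nat \<Rightarrow> complex^'v^'v" where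
  "distance_matrix adj i = (\<chi> y z. if gdist adj y z = i then 1 else 0)"

abbreviation adjacency_matrix :: "('v::finite \<Rightarrow> 'v \<Rightarrow> bool) \<Rightarrow> complex^'v^'v" where
  "adjacency_matrix adj \<equiv> distance_matrix adj 1"

definition char_vec :: "'v::finite set \<Rightarrow> complex^'v" where
  "char_vec Y = (\<chi> z. if z \<in> Y then 1 else 0)"


section \<open>The Bose-Mesner algebra and the Q-polynomial property\<close>

definition smult_matrix :: "complex \<Rightarrow> complex^'v::finite^'v \<Rightarrow> complex^'v^'v" where
  "smult_matrix c M = (\<chi> y z. c * M $ y $ z)"

definition hadamard :: "complex^'v::finite^'v \<Rightarrow> complex^'v^'v \<Rightarrow> complex^'v^'v" where
  "hadamard M N = (\<chi> y z. M $ y $ z * N $ y $ z)"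

inductive_set generated_algebra :: "complex^'v::finite^'v \<Rightarrow> (complex^'v^'v) set"
  for B :: "complex^'v^'v" where
  one: "Finite_Cartesian_Product.mat 1 \<in> generated_algebra B"
| gen: "B \<in> generated_algebra B"
| add: "M \<in> generated_algebra B \<Longrightarrow> N \<in> generated_algebra B \<Longrightarrow> M + N \<in> generated_algebra B"
| smult: "M \<in> generated_algebra B \<Longrightarrow> smult_matrix c M \<in> generated_algebra B"
| mult: "M \<in> generated_algebra B \<Longrightarrow> N \<in> generated_algebra B \<Longrightarrow> M ** N \<in> generated_algebra B"

definition bose_mesner :: "('v::finite \<Rightarrow> 'v \<Rightarrow> bool) \<Rightarrow> (complex^'v^'v) set" where
  "bose_mesner adj = generated_algebra (adjacency_matrix adj)"

definition primitive_idempotent :: "(complex^'v::finite^'v) set \<Rightarrow> complex^'v^'v \<Rightarrow> bool" where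
  "primitive_idempotent \<A> e \<longleftrightarrow> e \<in> \<A> \<and> e \<noteq> 0 \<and> e ** e = e \<and>
     (\<forall>f\<in>\<A>. \<forall>g\<in>\<A>. f ** f = f \<and> g ** g = g \<and> f ** g = 0 \<and> g ** f = 0 \<and> e = f + g
        \<longrightarrow> f = 0 \<or> g = 0)"

text \<open>\<open>E 0, \<dots>, E d\<close> is an ordering of the primitive idempotents with \<open>E 0 = J/|X|\<close>, and
  \<open>\<theta> i\<close> is the eigenvalue of the adjacency matrix for \<open>E i\<close>.\<close>

definition idempotent_ordering ::
  "('v::finite \<Rightarrow> 'v \<Rightarrow> bool) \<Rightarrow> nat \<Rightarrow> (nat \<Rightarrow> complex^'v^'v) \<Rightarrow> (nat \<Rightarrow> complex) \<Rightarrow> bool" where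
  "idempotent_ordering adj d E \<theta> \<longleftrightarrow>
     bij_betw E {0..d} {e. primitive_idempotent (bose_mesner adj) e} \<and>
     E 0 = (\<chi> y z. 1 / of_nat CARD('v)) \<and>
     adjacency_matrix adj = (\<Sum>i\<le>d. smult_matrix (\<theta> i) (E i))"

text \<open>The coefficients \<open>\<kappa> h i j\<close> are the Krein parameters \<open>q\<^sup>h\<^sub>i\<^sub>j\<close>.\<close>

definition q_polynomial :: "nat \<Rightarrow> (nat \<Rightarrow> complex^'v::finite^'v) \<Rightarrow> bool" where
  "q_polynomial d E \<longleftrightarrow>
     (\<exists>\<kappa> :: nat \<Rightarrow> nat \<Rightarrow> nat \<Rightarrow> complex.
        (\<forall>i\<le>d. \<forall>j\<le>d. hadamard (E i) (E j) =
           smult_matrix (1 / of_nat CARD('v)) (\<Sum>h\<le>d. smult_matrix (\<kappa> h i j) (E h))) \<and>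
        (\<forall>h\<le>d. \<forall>i\<le>d. \<forall>j\<le>d.
           (h > i + j \<or> i > h + j \<or> j > h + i \<longrightarrow> \<kappa> h i j = 0) \<and>
           (h = i + j \<or> i = h + j \<or> j = h + i \<longrightarrow> \<kappa> h i j \<noteq> 0)))"

definition dual_adjacency_matrix ::
  "(nat \<Rightarrow> complex^'v::finite^'v) \<Rightarrow> 'v \<Rightarrow> complex^'v^'v" where
  "dual_adjacency_matrix E x =
     (\<chi> y z. if y = z then of_nat CARD('v) * E 1 $ x $ z else 0)"

definition dual_idempotent ::
  "('v::finite \<Rightarrow> 'v \<Rightarrow> bool) \<Rightarrow> 'v \<Rightarrow> nat \<Rightarrow> complex^'v^'v" where
  "dual_idempotent adj x i = (\<chi> y z. if y = z \<and> gdist adj x z = i then 1 else 0)"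

definition primary_module :: "('v::finite \<Rightarrow> 'v \<Rightarrow> bool) \<Rightarrow> 'v \<Rightarrow> (complex^'v) set" where
  "primary_module adj x = {M *v char_vec {x} | M. M \<in> bose_mesner adj}"


section \<open>Delsarte cliques\<close>

definition delsarte_clique ::
  "('v::finite \<Rightarrow> 'v \<Rightarrow> bool) \<Rightarrow> real \<Rightarrow> 'v set \<Rightarrow> bool" where
  "delsarte_clique adj \<theta>min C \<longleftrightarrow>
     C \<noteq> {} \<and> (\<forall>y\<in>C. \<forall>z\<in>C. y \<noteq> z \<longrightarrow> adj y z) \<and>
     real (card C) = 1 - real (valency adj) / \<theta>min"

definition set_gdist :: "('v::finite \<Rightarrow> 'v \<Rightarrow> bool) \<Rightarrow> 'v \<Rightarrow> 'v set \<Rightarrow> nat" where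
  "set_gdist adj y C = Min (gdist adj y ` C)"

definition clique_cell :: "('v::finite \<Rightarrow> 'v \<Rightarrow> bool) \<Rightarrow> 'v set \<Rightarrow> nat \<Rightarrow> 'v set" where
  "clique_cell adj C i = {y. set_gdist adj y C = i}"

definition C_minus :: "('v::finite \<Rightarrow> 'v \<Rightarrow> bool) \<Rightarrow> 'v set \<Rightarrow> 'v \<Rightarrow> nat \<Rightarrow> 'v set" where
  "C_minus adj C x i = clique_cell adj C i \<inter> sphere_at adj i x"

definition C_plus :: "('v::finite \<Rightarrow> 'v \<Rightarrow> bool) \<Rightarrow> 'v set \<Rightarrow> 'v \<Rightarrow> nat \<Rightarrow> 'v set" where
  "C_plus adj C x i = clique_cell adj C i \<inter> sphere_at adj (i + 1) x"

definition W_basis ::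
  "('v::finite \<Rightarrow> 'v \<Rightarrow> bool) \<Rightarrow> nat \<Rightarrow> 'v set \<Rightarrow> 'v \<Rightarrow> (complex^'v) list" where
  "W_basis adj d C x =
     concat (map (\<lambda>i. [char_vec (C_minus adj C x i), char_vec (C_plus adj C x i)]) [0..<d])"

definition W_space ::
  "('v::finite \<Rightarrow> 'v \<Rightarrow> bool) \<Rightarrow> nat \<Rightarrow> 'v set \<Rightarrow> 'v \<Rightarrow> (complex^'v) set" where
  "W_space adj d C x =
     vec.span (\<Union>i<d. {char_vec (C_minus adj C x i), char_vec (C_plus adj C x i)})"


section \<open>Linear maps on a subspace\<close>

definition endo_on :: "(complex^'v::finite) set \<Rightarrow> (complex^'v \<Rightarrow> complex^'v) \<Rightarrow> bool" where
  "endo_on V f \<longleftrightarrow> (\<forall>u\<in>V. f u \<in> V) \<and> (\<forall>u\<in>V. \<forall>v\<in>V. f (u + v) = f u + f v) \<and>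
     (\<forall>c. \<forall>u\<in>V. f (c *s u) = c *s f u)"

definition zero_on :: "(complex^'v::finite) set \<Rightarrow> (complex^'v \<Rightarrow> complex^'v) \<Rightarrow> bool" where
  "zero_on V f \<longleftrightarrow> (\<forall>u\<in>V. f u = 0)"

definition ordered_basis :: "(complex^'v::finite) list \<Rightarrow> (complex^'v) set \<Rightarrow> bool" where
  "ordered_basis ws V \<longleftrightarrow> distinct ws \<and> vec.independent (set ws) \<and> vec.span (set ws) = V"

definition represents ::
  "complex mat \<Rightarrow> (complex^'v::finite \<Rightarrow> complex^'v) \<Rightarrow> (complex^'v) list \<Rightarrow> (complex^'v) set \<Rightarrow> bool"
where
  "represents N f ws V \<longleftrightarrow> ordered_basis ws V \<and> N \<in> carrier_mat (length ws) (length ws) \<and>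
     (\<forall>j<length ws. f (ws ! j) = (\<Sum>i<length ws. N $$ (i, j) *s (ws ! i)))"


section \<open>Leonard systems\<close>

definition eigenspace_on ::
  "(complex^'v::finite) set \<Rightarrow> (complex^'v \<Rightarrow> complex^'v) \<Rightarrow> complex \<Rightarrow> (complex^'v) set" where
  "eigenspace_on V f \<eta> = {u \<in> V. f u = \<eta> *s u}"

definition eigenvalues_on ::
  "(complex^'v::finite) set \<Rightarrow> (complex^'v \<Rightarrow> complex^'v) \<Rightarrow> complex set" where
  "eigenvalues_on V f = {\<eta>. \<exists>u\<in>eigenspace_on V f \<eta>. u \<noteq> 0}"

text \<open>For \<open>f\<close> diagonalizable on \<open>V\<close>: \<open>p\<close> is the projection onto the \<open>\<eta>\<close>-eigenspace along the
  other eigenspaces.\<close>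

definition spectral_projection ::
  "(complex^'v::finite) set \<Rightarrow> (complex^'v \<Rightarrow> complex^'v) \<Rightarrow> complex \<Rightarrow>
     (complex^'v \<Rightarrow> complex^'v) \<Rightarrow> bool" where
  "spectral_projection V f \<eta> p \<longleftrightarrow> endo_on V p \<and>
     (\<forall>u\<in>eigenspace_on V f \<eta>. p u = u) \<and>
     (\<forall>\<mu>. \<mu> \<noteq> \<eta> \<longrightarrow> (\<forall>u\<in>eigenspace_on V f \<mu>. p u = 0))"

definition spectral_ordering ::
  "(complex^'v::finite) set \<Rightarrow> nat \<Rightarrow> (complex^'v \<Rightarrow> complex^'v) \<Rightarrow>
     (nat \<Rightarrow> complex^'v \<Rightarrow> complex^'v) \<Rightarrow> bool" where
  "spectral_ordering V n B F \<longleftrightarrow>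
     (\<exists>\<eta>. bij_betw \<eta> {0..n} (eigenvalues_on V B) \<and>
        (\<forall>i\<le>n. spectral_projection V B (\<eta> i) (F i)))"

definition tridiagonal_pattern ::
  "(complex^'v::finite) set \<Rightarrow> nat \<Rightarrow> (complex^'v \<Rightarrow> complex^'v) \<Rightarrow>
     (nat \<Rightarrow> complex^'v \<Rightarrow> complex^'v) \<Rightarrow> bool" where
  "tridiagonal_pattern V n B F \<longleftrightarrow>
     (\<forall>i\<le>n. \<forall>j\<le>n.
        (i > j + 1 \<or> j > i + 1 \<longrightarrow> zero_on V (F i \<circ> B \<circ> F j)) \<and>
        (i = j + 1 \<or> j = i + 1 \<longrightarrow> \<not> zero_on V (F i \<circ> B \<circ> F j)))"

text \<open>Only the restrictions of the maps to \<open>V\<close> matter.\<close>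

definition leonard_system ::
  "(complex^'v::finite) set \<Rightarrow> nat \<Rightarrow> (complex^'v \<Rightarrow> complex^'v) \<Rightarrow> (complex^'v \<Rightarrow> complex^'v) \<Rightarrow>
     (nat \<Rightarrow> complex^'v \<Rightarrow> complex^'v) \<Rightarrow> (nat \<Rightarrow> complex^'v \<Rightarrow> complex^'v) \<Rightarrow> bool" where
  "leonard_system V n B Bs F Fs \<longleftrightarrow>
     vec.subspace V \<and> vec.dim V = n + 1 \<and> endo_on V B \<and> endo_on V Bs \<and>
     card (eigenvalues_on V B) = n + 1 \<and> card (eigenvalues_on V Bs) = n + 1 \<and>
     spectral_ordering V n B F \<and> spectral_ordering V n Bs Fs \<and>
     tridiagonal_pattern V n Bs F \<and> tridiagonal_pattern V n B Fs"

definition eigenvalue_sequence ::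
  "(complex^'v::finite) set \<Rightarrow> nat \<Rightarrow> (complex^'v \<Rightarrow> complex^'v) \<Rightarrow>
     (nat \<Rightarrow> complex^'v \<Rightarrow> complex^'v) \<Rightarrow> (nat \<Rightarrow> complex) \<Rightarrow> bool" where
  "eigenvalue_sequence V n B F \<theta> \<longleftrightarrow> (\<forall>i\<le>n. \<forall>u\<in>V. B (F i u) = \<theta> i *s F i u)"

definition lower_bidiagonal :: "nat \<Rightarrow> (nat \<Rightarrow> complex) \<Rightarrow> complex mat" where
  "lower_bidiagonal n \<theta> =
     Matrix.mat (n + 1) (n + 1) (\<lambda>(i, j). if i = j then \<theta> i else if i = j + 1 then 1 else 0)"

definition upper_bidiagonal :: "nat \<Rightarrow> (nat \<Rightarrow> complex) \<Rightarrow> (nat \<Rightarrow> complex) \<Rightarrow> complex mat" where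
  "upper_bidiagonal n \<theta>s \<phi> =
     Matrix.mat (n + 1) (n + 1) (\<lambda>(i, j). if i = j then \<theta>s i else if j = i + 1 then \<phi> j else 0)"

definition first_split_sequence ::
  "(complex^'v::finite) set \<Rightarrow> nat \<Rightarrow> (complex^'v \<Rightarrow> complex^'v) \<Rightarrow> (complex^'v \<Rightarrow> complex^'v) \<Rightarrow>
     (nat \<Rightarrow> complex^'v \<Rightarrow> complex^'v) \<Rightarrow> (nat \<Rightarrow> complex^'v \<Rightarrow> complex^'v) \<Rightarrow>
     (nat \<Rightarrow> complex) \<Rightarrow> bool" where
  "first_split_sequence V n B Bs F Fs \<phi> \<longleftrightarrow>
     (\<forall>i\<in>{1..n}. \<phi> i \<noteq> 0) \<and>
     (\<exists>\<theta> \<theta>s ws. eigenvalue_sequence V n B F \<theta> \<and> eigenvalue_sequence V n Bs Fs \<theta>s \<and>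
        represents (lower_bidiagonal n \<theta>) B ws V \<and>
        represents (upper_bidiagonal n \<theta>s \<phi>) Bs ws V)"

definition parameter_array ::
  "(complex^'v::finite) set \<Rightarrow> nat \<Rightarrow> (complex^'v \<Rightarrow> complex^'v) \<Rightarrow> (complex^'v \<Rightarrow> complex^'v) \<Rightarrow>
     (nat \<Rightarrow> complex^'v \<Rightarrow> complex^'v) \<Rightarrow> (nat \<Rightarrow> complex^'v \<Rightarrow> complex^'v) \<Rightarrow>
     (nat \<Rightarrow> complex) \<Rightarrow> (nat \<Rightarrow> complex) \<Rightarrow> (nat \<Rightarrow> complex) \<Rightarrow> (nat \<Rightarrow> complex) \<Rightarrow> bool" where
  "parameter_array V n B Bs F Fs \<theta> \<theta>s \<phi>1 \<phi>2 \<longleftrightarrow>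
     eigenvalue_sequence V n B F \<theta> \<and> eigenvalue_sequence V n Bs Fs \<theta>s \<and>
     first_split_sequence V n B Bs F Fs \<phi>1 \<and>
     first_split_sequence V n B Bs (\<lambda>i. F (n - i)) Fs \<phi>2"

text \<open>Exponents that may be negative are written with \<open>powi\<close>. The sequences \<open>\<phi>1\<close> and \<open>\<phi>2\<close> are
  the first and the second split sequence.\<close>

definition q_racah ::
  "nat \<Rightarrow> complex \<Rightarrow> complex \<Rightarrow> complex \<Rightarrow> complex \<Rightarrow> complex \<Rightarrow> complex \<Rightarrow> complex \<Rightarrow>
     (nat \<Rightarrow> complex) \<Rightarrow> (nat \<Rightarrow> complex) \<Rightarrow> (nat \<Rightarrow> complex) \<Rightarrow> (nat \<Rightarrow> complex) \<Rightarrow> bool" where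
  "q_racah d q h hs s ss r1 r2 \<theta> \<theta>s \<phi>1 \<phi>2 \<longleftrightarrow>
     h \<noteq> 0 \<and> hs \<noteq> 0 \<and> s \<noteq> 0 \<and> ss \<noteq> 0 \<and> r1 \<noteq> 0 \<and> r2 \<noteq> 0 \<and>
     r1 * r2 = s * ss * q ^ (d + 1) \<and>
     (\<forall>i\<in>{1..d}. q ^ i \<noteq> 1 \<and> r1 * q ^ i \<noteq> 1 \<and> r2 * q ^ i \<noteq> 1 \<and>
        ss * q ^ i / r1 \<noteq> 1 \<and> ss * q ^ i / r2 \<noteq> 1) \<and>
     (\<forall>i\<in>{2..2 * d}. s * q ^ i \<noteq> 1 \<and> ss * q ^ i \<noteq> 1) \<and>
     (\<forall>i\<le>d. \<theta> i = \<theta> 0 + h * (1 - q ^ i) * (1 - s * q ^ (i + 1)) * q powi (- int i)) \<and>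
     (\<forall>i\<le>d. \<theta>s i = \<theta>s 0 + hs * (1 - q ^ i) * (1 - ss * q ^ (i + 1)) * q powi (- int i)) \<and>
     (\<forall>i\<in>{1..d}. \<phi>1 i = h * hs * q powi (1 - 2 * int i) * (1 - q ^ i)
        * (1 - q powi (int i - int d - 1)) * (1 - r1 * q ^ i) * (1 - r2 * q ^ i)) \<and>
     (\<forall>i\<in>{1..d}. \<phi>2 i = h * hs * q powi (1 - 2 * int i) * (1 - q ^ i)
        * (1 - q powi (int i - int d - 1)) * (r1 - ss * q ^ i) * (r2 - ss * q ^ i) / ss)"


section \<open>The algebra and its modules\<close>

text \<open>The free algebra over \<open>complex\<close> on a set of symbols is the monoid algebra of the free monoid
  of words; the product of \<open>Poly_Mapping\<close> is convolution with respect to \<open>+\<close> on the exponents,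
  so concatenation of words is written additively.\<close>

datatype 'g free_monoid = Word "'g list"

instantiation free_monoid :: (type) monoid_add
begin

definition zero_free_monoid :: "'a free_monoid" where
  "0 = Word []"

fun plus_free_monoid :: "'a free_monoid \<Rightarrow> 'a free_monoid \<Rightarrow> 'a free_monoid" where
  "Word u + Word v = Word (u @ v)"

instance
proof
  fix a b c :: "'a free_monoid"
  show "a + b + c = a + (b + c)" by (cases a; cases b; cases c) simp
  show "0 + a = a" by (cases a) (simp add: zero_free_monoid_def)
  show "a + 0 = a" by (cases a) (simp add: zero_free_monoid_def)
qed

end

type_synonym 'g free_algebra = "'g free_monoid \<Rightarrow>\<^sub>0 complex"

definition free_alg_ring :: "'g free_algebra ring" where
  "free_alg_ring = \<lparr>carrier = UNIV, monoid.mult = (*), one = 1, zero = 0, add = (+)\<rparr>"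

definition fscalar :: "complex \<Rightarrow> 'g free_algebra" where
  "fscalar c = Poly_Mapping.single 0 c"

definition fgen :: "'g \<Rightarrow> 'g free_algebra" where
  "fgen g = Poly_Mapping.single (Word [g]) 1"

text \<open>The symbols for \<open>t\<^sub>n\<close> and its inverse, \<open>n\<close> in the four-element type of residues
  \<open>0, 1, 2, 3\<close>.\<close>

datatype hsym = Gen 4 | GenInv 4

definition H_relators :: "complex \<Rightarrow> hsym free_algebra set" where
  "H_relators qhalf =
     {fgen (Gen n) * fgen (GenInv n) - 1 | n. True} \<union>
     {fgen (GenInv n) * fgen (Gen n) - 1 | n. True} \<union>
     {(fgen (Gen n) + fgen (GenInv n)) * a - a * (fgen (Gen n) + fgen (GenInv n)) | n a. True} \<union>
     {fgen (Gen 0) * fgen (Gen 1) * fgen (Gen 2) * fgen (Gen 3) - fscalar (inverse qhalf)}"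

definition H_ideal :: "complex \<Rightarrow> hsym free_algebra set" where
  "H_ideal qhalf = Idl\<^bsub>free_alg_ring\<^esub> (H_relators qhalf)"

definition H_hat :: "complex \<Rightarrow> hsym free_algebra set ring" where
  "H_hat qhalf = free_alg_ring Quot (H_ideal qhalf)"

definition H_class :: "complex \<Rightarrow> hsym free_algebra \<Rightarrow> hsym free_algebra set" where
  "H_class qhalf a = H_ideal qhalf +>\<^bsub>free_alg_ring\<^esub> a"

definition H_gen :: "complex \<Rightarrow> 4 \<Rightarrow> hsym free_algebra set" where
  "H_gen qhalf n = H_class qhalf (fgen (Gen n))"

text \<open>A left module structure on a subspace \<open>W\<close>, extending its vector space structure, over a
  (not necessarily commutative) algebra \<open>R\<close> with structure map \<open>\<iota>\<close> from the scalars.\<close>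

definition module_structure ::
  "('r, 'm) ring_scheme \<Rightarrow> (complex \<Rightarrow> 'r) \<Rightarrow> (complex^'v::finite) set \<Rightarrow>
     ('r \<Rightarrow> complex^'v \<Rightarrow> complex^'v) \<Rightarrow> bool" where
  "module_structure R \<iota> W act \<longleftrightarrow>
     (\<forall>a\<in>carrier R. endo_on W (act a)) \<and>
     (\<forall>a\<in>carrier R. \<forall>b\<in>carrier R. \<forall>w\<in>W. act (a \<oplus>\<^bsub>R\<^esub> b) w = act a w + act b w) \<and>
     (\<forall>a\<in>carrier R. \<forall>b\<in>carrier R. \<forall>w\<in>W. act (a \<otimes>\<^bsub>R\<^esub> b) w = act a (act b w)) \<and>
     (\<forall>w\<in>W. act \<one>\<^bsub>R\<^esub> w = w) \<and>
     (\<forall>c. \<forall>w\<in>W. act (\<iota> c) w = c *s w)"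


section \<open>The representing matrices\<close>

definition P_coeff :: "complex \<Rightarrow> complex \<Rightarrow> complex \<Rightarrow> complex \<Rightarrow> nat \<Rightarrow> complex" where
  "P_coeff q ss r1 r2 i =
     (r1 - ss * q ^ (i + 1)) * (r2 - ss * q ^ (i + 1)) / (1 - ss * q ^ (2 * i + 2))"

definition R_coeff :: "complex \<Rightarrow> complex \<Rightarrow> complex \<Rightarrow> complex \<Rightarrow> nat \<Rightarrow> complex" where
  "R_coeff q ss r1 r2 i =
     (1 - r1 * q ^ (i + 1)) * (1 - r2 * q ^ (i + 1)) / (1 - ss * q ^ (2 * i + 2))"

definition U_coeff :: "nat \<Rightarrow> complex \<Rightarrow> complex \<Rightarrow> nat \<Rightarrow> complex" where
  "U_coeff d q ss i =
     (1 - q powi (int i - int d)) * (1 - ss * q ^ (i + 1)) / (1 - ss * q ^ (2 * i + 1))"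

definition V_coeff :: "nat \<Rightarrow> complex \<Rightarrow> complex \<Rightarrow> nat \<Rightarrow> complex" where
  "V_coeff d q ss i = (1 - q ^ i) * (1 - ss * q ^ (d + i + 1)) / (1 - ss * q ^ (2 * i + 1))"

definition Z_coeff :: "nat \<Rightarrow> complex \<Rightarrow> complex \<Rightarrow> nat \<Rightarrow> complex" where
  "Z_coeff d q ss i = (1 - q ^ i) * (1 - q powi (int i - int d)) / (1 - ss * q ^ (2 * i + 1))"

text \<open>The arguments \<open>qh, ssh, r1h, r2h\<close> are the chosen square roots of \<open>q, s\<^sup>*, r\<^sub>1, r\<^sub>2\<close>;
  half-integral powers of \<open>q\<close> are integral powers of \<open>qh\<close>.\<close>

definition t0_block :: "complex \<Rightarrow> complex \<Rightarrow> complex \<Rightarrow> complex \<Rightarrow> nat \<Rightarrow> complex mat" where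
  "t0_block qh ssh r1h r2h i =
    (let \<sigma> = ssh; \<rho> = r1h * r2h; ss = ssh^2;
         P = P_coeff (qh^2) ss (r1h^2) (r2h^2) i;
         R = R_coeff (qh^2) ss (r1h^2) (r2h^2) i
     in mat_of_rows_list 2
       [[(P + ss) / (\<sigma> * \<rho>), - (\<sigma> / \<rho>) * R],
        [P / (\<sigma> * \<rho>),        (\<sigma> / \<rho>) * (1 - R)]])"

definition t3_block :: "complex \<Rightarrow> complex \<Rightarrow> complex \<Rightarrow> complex \<Rightarrow> nat \<Rightarrow> complex mat" where
  "t3_block qh ssh r1h r2h i =
    (let \<rho> = r1h * r2h; ss = ssh^2; q = qh^2;
         P = P_coeff q ss (r1h^2) (r2h^2) i;
         R = R_coeff q ss (r1h^2) (r2h^2) i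
     in mat_of_rows_list 2
       [[(1 - R) / (q ^ (i + 1) * \<rho>), R / (q ^ (i + 1) * \<rho>)],
        [- (q ^ (i + 1) / \<rho>) * P,     (q ^ (i + 1) / \<rho>) * (P + ss)]])"

definition t1_block :: "nat \<Rightarrow> complex \<Rightarrow> complex \<Rightarrow> nat \<Rightarrow> complex mat" where
  "t1_block d qh ssh i =
    (let U = U_coeff d (qh^2) (ssh^2) i; V = V_coeff d (qh^2) (ssh^2) i
     in if i = 0 \<or> i = d then mat_of_rows_list 1 [[inverse (qh ^ d)]]
        else mat_of_rows_list 2
          [[qh ^ d * U + inverse (qh ^ d), - (qh ^ d) * U],
           [inverse (qh ^ d) * V,          inverse (qh ^ d) * (1 - V)]])"

definition t2_block :: "nat \<Rightarrow> complex \<Rightarrow> complex \<Rightarrow> nat \<Rightarrow> complex mat" where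
  "t2_block d qh ssh i =
    (let \<kappa> = ssh * qh ^ (d + 1); q = qh^2;
         U = U_coeff d q (ssh^2) i; V = V_coeff d q (ssh^2) i; Z = Z_coeff d q (ssh^2) i
     in if i = 0 then mat_of_rows_list 1 [[\<kappa>]]
        else if i = d then mat_of_rows_list 1 [[inverse \<kappa>]]
        else mat_of_rows_list 2
          [[(\<kappa>^2 * Z + 1) / \<kappa>,   q ^ i * \<kappa> * U],
           [- (V / (q ^ i * \<kappa>)),  \<kappa> * (1 - Z)]])"

definition T_matrix ::
  "nat \<Rightarrow> complex \<Rightarrow> complex \<Rightarrow> complex \<Rightarrow> complex \<Rightarrow> 4 \<Rightarrow> complex mat" where
  "T_matrix d qh ssh r1h r2h n =
    (if n = 0 then diag_block_mat (map (t0_block qh ssh r1h r2h) [0..<d])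
     else if n = 1 then diag_block_mat (map (t1_block d qh ssh) [0..<d + 1])
     else if n = 2 then diag_block_mat (map (t2_block d qh ssh) [0..<d + 1])
     else diag_block_mat (map (t3_block qh ssh r1h r2h) [0..<d]))"

end

theory Submission
  imports Defs
begin

text \<open>
  There are two things to prove: that the characteristic vectors of the cells form a basis of their
  span, and that the four matrices satisfy the relations of the algebra.

  The cells are pairwise disjoint, so the first part says that none of them is empty. The
  quadratic form of \<open>E d\<close> on the characteristic vector of a Delsarte clique is zero; as \<open>E d\<close> is
  positive semidefinite, it annihilates that vector. The polynomial \<open>\<Prod>i=1..d-1. (A - \<theta> i)\<close> in the
  adjacency matrix then sends it to a nonzero constant vector, so that every vertex is at distance
  at most \<open>d - 1\<close> from the clique (\<open>delsarte_covering_radius\<close>). A vertex \<open>y\<close> at distance \<open>d\<close> from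
  \<open>x\<close> therefore has distance \<open>d - 1\<close> to some \<open>z\<close> in the clique, and a geodesic from \<open>z\<close> to \<open>y\<close>
  passes through all cells \<open>C\<^sub>i\<^sup>+\<close>. Counting vertices shows that \<open>|C\<^sub>i\<^sup>-|\<close> does not depend on
  the base point in the clique (\<open>card_C_minus_independent\<close>). For the base point \<open>z\<close> the vertex \<open>y\<close>
  lies in \<open>C\<^sub>i\<^sup>-\<close> with \<open>i = d - 1\<close>; so that cell is nonempty for \<open>x\<close> as well, and a geodesic from
  \<open>x\<close> into it meets all the others.

  For the second part, every \<open>2\<times>2\<close> block of the \<open>n\<close>th matrix has determinant one and a trace that
  does not depend on the block, and the \<open>1\<times>1\<close> blocks are roots of the same quadratic polynomial
  (\<open>operator_quadratic\<close>). Hence the matrix plus its inverse is a scalar. The product of the matrices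
  for \<open>t\<^sub>1\<close> and \<open>t\<^sub>2\<close> is diagonal (\<open>t1_t2_diagonal\<close>), which reduces the last relation to a product
  of \<open>2\<times>2\<close> blocks (\<open>operator_product\<close>). Finally, operators that satisfy the relators give a module
  over the algebra presented by them (\<open>quotient_module_structure\<close>).
\<close>

section \<open>Modules over a finitely presented algebra\<close>

text \<open>The operator by which a word acts once each symbol \<open>g\<close> acts by \<open>T g\<close>; the leftmost symbol
  is applied last.\<close>

definition word_op :: "('g \<Rightarrow> 'a \<Rightarrow> 'a) \<Rightarrow> 'g free_monoid \<Rightarrow> 'a \<Rightarrow> 'a" where
  "word_op T w = (case w of Word gs \<Rightarrow> foldr T gs)"

text \<open>The extension of \<^term>\<open>word_op T\<close> to the free algebra by linearity.\<close>

definition alg_op ::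
  "('g \<Rightarrow> complex^'v::finite \<Rightarrow> complex^'v) \<Rightarrow> 'g free_algebra \<Rightarrow> complex^'v \<Rightarrow> complex^'v" where
  "alg_op T p v = (\<Sum>w\<in>Poly_Mapping.keys p. Poly_Mapping.lookup p w *s word_op T w v)"

lemma word_op_zero [simp]: "word_op T 0 v = v"
  by (simp add: word_op_def zero_free_monoid_def)

lemma word_op_add: "word_op T (u + w) v = word_op T u (word_op T w v)"
  by (cases u; cases w) (simp add: word_op_def)

lemma linear_word_op:
  fixes T :: "'g \<Rightarrow> complex^'v::finite \<Rightarrow> complex^'v"
  assumes "\<And>g. Vector_Spaces.linear (*s) (*s) (T g)"
  shows "Vector_Spaces.linear (*s) (*s) (word_op T w)"
proof (cases w)
  case (Word gs)
  have "Vector_Spaces.linear (*s) (*s) (foldr T gs)"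
  proof (induction gs)
    case Nil
    show ?case by (simp add: vec.linear_id[unfolded id_def] id_def)
  next
    case (Cons g gs)
    show ?case using Vector_Spaces.linear_compose[OF Cons.IH assms[of g]] by (simp add: comp_def)
  qed
  then show ?thesis by (simp add: Word word_op_def)
qed

lemma alg_op_superset:
  assumes "finite S" "Poly_Mapping.keys p \<subseteq> S"
  shows "alg_op T p v = (\<Sum>w\<in>S. Poly_Mapping.lookup p w *s word_op T w v)"
  unfolding alg_op_def using assms
  by (intro sum.mono_neutral_left) (auto simp: in_keys_iff)

lemma alg_op_zero [simp]: "alg_op T 0 v = 0"
  by (simp add: alg_op_def)

lemma alg_op_add: "alg_op T (a + b) v = alg_op T a v + alg_op T b v"
proof -
  let ?S = "Poly_Mapping.keys a \<union> Poly_Mapping.keys b"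
  have "alg_op T (a + b) v = (\<Sum>w\<in>?S. Poly_Mapping.lookup (a + b) w *s word_op T w v)"
    by (rule alg_op_superset) (auto simp: Poly_Mapping.keys_add)
  also have "\<dots> = (\<Sum>w\<in>?S. Poly_Mapping.lookup a w *s word_op T w v)
      + (\<Sum>w\<in>?S. Poly_Mapping.lookup b w *s word_op T w v)"
    by (simp add: lookup_add vec.scale_left_distrib sum.distrib)
  finally show ?thesis by (simp add: alg_op_superset[of ?S])
qed

lemma alg_op_minus: "alg_op T (a - b) v = alg_op T a v - alg_op T b v"
  using alg_op_add[of T "a - b" b v] by simp

lemma alg_op_sum: "alg_op T (\<Sum>i\<in>I. f i) v = (\<Sum>i\<in>I. alg_op T (f i) v)"
  by (induction I rule: infinite_finite_induct) (auto simp: alg_op_add)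

lemma alg_op_single [simp]: "alg_op T (Poly_Mapping.single w c) v = c *s word_op T w v"
  by (cases "c = 0") (simp_all add: alg_op_def)

lemma linear_alg_op:
  assumes "\<And>g. Vector_Spaces.linear (*s) (*s) (T g)"
  shows "Vector_Spaces.linear (*s) (*s) (alg_op T a)"
proof -
  note lw = linear_word_op[where T=T, OF assms]
  show ?thesis
    unfolding Vector_Spaces.linear_iff alg_op_def
    by (auto simp: vec.vector_space_axioms vec.linear_add[OF lw] vec.linear_scale[OF lw] vec.scale_right_distrib sum.distrib
        vec.scale_sum_right vec.scale_left_commute mult.commute)
qed

lemma free_algebra_decompose:
  "a = (\<Sum>w\<in>Poly_Mapping.keys a. Poly_Mapping.single w (Poly_Mapping.lookup a w))"
  by (rule poly_mapping_eqI)
    (auto simp: lookup_sum lookup_single when_def in_keys_iff if_distrib cong: if_cong)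

lemma alg_op_mult:
  assumes "\<And>g. Vector_Spaces.linear (*s) (*s) (T g)"
  shows "alg_op T (a * b) v = alg_op T a (alg_op T b v)"
proof -
  note la = linear_alg_op[where T=T, OF assms]
  have 1: "alg_op T (Poly_Mapping.single u c * b) v = alg_op T (Poly_Mapping.single u c) (alg_op T b v)"
    for u c
  proof -
    have "alg_op T (Poly_Mapping.single u c * b) v
       = (\<Sum>w\<in>Poly_Mapping.keys b. alg_op T (Poly_Mapping.single u c * Poly_Mapping.single w (Poly_Mapping.lookup b w)) v)"
      by (subst free_algebra_decompose[of b]) (simp add: sum_distrib_left alg_op_sum)
    also have "\<dots> = (\<Sum>w\<in>Poly_Mapping.keys b. alg_op T (Poly_Mapping.single u c)
         (alg_op T (Poly_Mapping.single w (Poly_Mapping.lookup b w)) v))"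
      using vec.linear_scale[OF linear_word_op[where T=T, OF assms]]
      by (simp add: mult_single word_op_add)
    also have "\<dots> = alg_op T (Poly_Mapping.single u c) (alg_op T b v)"
      by (subst (3) free_algebra_decompose[of b]) (simp only: alg_op_sum vec.linear_sum[OF la])
    finally show ?thesis .
  qed
  have "alg_op T (a * b) v
     = (\<Sum>w\<in>Poly_Mapping.keys a. alg_op T (Poly_Mapping.single w (Poly_Mapping.lookup a w) * b) v)"
    by (subst free_algebra_decompose[of a]) (simp add: sum_distrib_right alg_op_sum)
  also have "\<dots> = alg_op T a (alg_op T b v)"
    unfolding 1 by (subst (3) free_algebra_decompose[of a]) (simp only: alg_op_sum)
  finally show ?thesis .
qed

lemma alg_op_fscalar [simp]: "alg_op T (fscalar c) v = c *s v"
  by (simp add: fscalar_def)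

lemma alg_op_one [simp]: "alg_op T 1 v = v"
  using alg_op_fscalar[of T 1 v] by (simp add: fscalar_def)

lemma alg_op_fgen [simp]: "alg_op T (fgen g) v = T g v"
  by (simp add: fgen_def word_op_def)

lemma alg_op_invariant:
  assumes "vec.subspace W" "\<And>g w. w \<in> W \<Longrightarrow> T g w \<in> W" "w \<in> W"
  shows "alg_op T a w \<in> W"
proof -
  have "word_op T u w \<in> W" for u
  proof (cases u)
    case (Word gs)
    have "foldr T gs w \<in> W" by (induction gs) (auto simp: assms)
    then show ?thesis by (simp add: Word word_op_def)
  qed
  then show ?thesis
    unfolding alg_op_def using assms(1) by (intro vec.subspace_sum vec.subspace_scale) auto
qed

lemma free_alg_ring_simps [simp]:
  "carrier free_alg_ring = UNIV" "x \<otimes>\<^bsub>free_alg_ring\<^esub> y = x * y" "\<one>\<^bsub>free_alg_ring\<^esub> = 1"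
  "\<zero>\<^bsub>free_alg_ring\<^esub> = 0" "x \<oplus>\<^bsub>free_alg_ring\<^esub> y = x + y"
  by (simp_all add: free_alg_ring_def)

lemma ring_free_alg_ring: "ring (free_alg_ring :: 'g free_algebra ring)"
proof (rule ringI)
  show "abelian_group (free_alg_ring :: 'g free_algebra ring)"
  proof (rule abelian_groupI)
    fix x :: "'g free_algebra"
    show "\<exists>y\<in>carrier free_alg_ring. y \<oplus>\<^bsub>free_alg_ring\<^esub> x = \<zero>\<^bsub>free_alg_ring\<^esub>"
      by (auto intro: exI[of _ "- x"])
  qed (auto simp: algebra_simps)
  show "Group.monoid (free_alg_ring :: 'g free_algebra ring)"
    by (rule monoidI) (auto simp: algebra_simps)
qed (auto simp: algebra_simps)

text \<open>Invariance of \<open>W\<close> is what makes the annihilator a two-sided ideal.\<close>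

lemma ideal_annihilator:
  assumes lin: "\<And>g. Vector_Spaces.linear (*s) (*s) (T g)"
    and "vec.subspace W" and "\<And>g w. w \<in> W \<Longrightarrow> T g w \<in> W"
  shows "ideal {a. \<forall>w\<in>W. alg_op T a w = 0} free_alg_ring" (is "ideal ?K _")
proof (rule idealI[OF ring_free_alg_ring])
  interpret R: ring "free_alg_ring :: 'a free_algebra ring" by (rule ring_free_alg_ring)
  have inv: "\<ominus>\<^bsub>free_alg_ring\<^esub> a = - a" for a :: "'a free_algebra"
    by (rule R.minus_equality) auto
  show "subgroup ?K (add_monoid free_alg_ring)"
  proof (rule R.add.subgroupI)
    fix a assume "a \<in> ?K"
    then have "- a \<in> ?K" using alg_op_minus[of T 0 a] by auto
    then show "\<ominus>\<^bsub>free_alg_ring\<^esub> a \<in> ?K" by (simp only: inv)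
  qed (auto simp: alg_op_add intro: exI[of _ 0])
  fix a x assume "a \<in> ?K"
  then show "x \<otimes>\<^bsub>free_alg_ring\<^esub> a \<in> ?K" "a \<otimes>\<^bsub>free_alg_ring\<^esub> x \<in> ?K"
    using alg_op_invariant[where T=T, OF assms(2,3)] vec.linear_0[OF linear_alg_op[where T=T, OF lin]]
    by (auto simp: alg_op_mult[where T=T, OF lin])
qed

text \<open>Operators that satisfy the relators on an invariant subspace make that subspace a module
  over the quotient algebra.\<close>

lemma quotient_module_structure:
  fixes T :: "'g \<Rightarrow> complex^'v::finite \<Rightarrow> complex^'v" and S :: "'g free_algebra set"
  defines "I \<equiv> Idl\<^bsub>free_alg_ring\<^esub> S"
  assumes lin: "\<And>g. Vector_Spaces.linear (*s) (*s) (T g)"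
    and sub: "vec.subspace W" and inv: "\<And>g w. w \<in> W \<Longrightarrow> T g w \<in> W"
    and rel: "\<And>r w. r \<in> S \<Longrightarrow> w \<in> W \<Longrightarrow> alg_op T r w = 0"
  shows "\<exists>act. module_structure (free_alg_ring Quot I) (\<lambda>c. I +>\<^bsub>free_alg_ring\<^esub> fscalar c) W act \<and>
           (\<forall>a. \<forall>w\<in>W. act (I +>\<^bsub>free_alg_ring\<^esub> a) w = alg_op T a w)"
proof -
  interpret R: ring "free_alg_ring :: 'g free_algebra ring" by (rule ring_free_alg_ring)
  interpret I: ideal I free_alg_ring
    unfolding I_def by (rule R.genideal_ideal) auto
  interpret Q: ring "free_alg_ring Quot I" by (rule I.quotient_is_ring)
  have "I \<subseteq> {a. \<forall>w\<in>W. alg_op T a w = 0}"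
    unfolding I_def using ideal_annihilator[where T=T, OF lin sub inv] rel
    by (intro R.genideal_minimal) auto
  then have kill: "alg_op T a w = 0" if "a \<in> I" "w \<in> W" for a w using that by auto
  let ?c = "\<lambda>a. I +>\<^bsub>free_alg_ring\<^esub> a"
  \<comment> \<open>A coset acts by an arbitrary representative, as \<open>I\<close> annihilates \<open>W\<close>.\<close>
  define act where "act = (\<lambda>X w. alg_op T (SOME a. X = ?c a) w)"
  have act: "act (?c a) w = alg_op T a w" if "w \<in> W" for a w
  proof -
    define b where "b = (SOME b. ?c a = ?c b)"
    have b: "?c a = ?c b" unfolding b_def by (rule someI[of _ a]) simp
    then have "a \<in> ?c b" using I.a_rcos_self[of a] by simp
    then obtain i where "i \<in> I" "a = i + b"
      by (auto simp: a_r_coset_def r_coset_def)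
    then have "alg_op T a w = alg_op T b w" using kill[OF _ that] by (simp add: alg_op_add)
    then show ?thesis by (simp add: act_def b_def)
  qed
  have hom: "?c (a + b) = ?c a \<oplus>\<^bsub>free_alg_ring Quot I\<^esub> ?c b"
    "?c (a * b) = ?c a \<otimes>\<^bsub>free_alg_ring Quot I\<^esub> ?c b"
    "?c 1 = \<one>\<^bsub>free_alg_ring Quot I\<^esub>" for a b
    using ring_hom_add[OF I.rcos_ring_hom, of a b] ring_hom_mult[OF I.rcos_ring_hom, of a b]
      ring_hom_one[OF I.rcos_ring_hom] by simp_all
  have car: "\<exists>a. X = ?c a" if "X \<in> carrier (free_alg_ring Quot I)" for X
    using that by (auto simp: FactRing_def A_RCOSETS_def' )
  have "module_structure (free_alg_ring Quot I) (\<lambda>c. ?c (fscalar c)) W act"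
    unfolding module_structure_def
  proof (intro conjI ballI allI)
    fix X assume "X \<in> carrier (free_alg_ring Quot I)"
    then obtain a where X: "X = ?c a" using car by blast
    note la = linear_alg_op[where T=T, OF lin]
    show "endo_on W (act X)"
      unfolding endo_on_def X
      by (auto simp: act alg_op_invariant[where T=T, OF sub inv] vec.subspace_add[OF sub]
          vec.subspace_scale[OF sub] vec.linear_add[OF la] vec.linear_scale[OF la])
  next
    fix X Y w assume "X \<in> carrier (free_alg_ring Quot I)" "Y \<in> carrier (free_alg_ring Quot I)"
      and w: "w \<in> W"
    then obtain a b where X: "X = ?c a" "Y = ?c b" using car by blast
    show "act (X \<oplus>\<^bsub>free_alg_ring Quot I\<^esub> Y) w = act X w + act Y w"
      unfolding X hom(1)[symmetric] using w by (simp add: act alg_op_add)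
    show "act (X \<otimes>\<^bsub>free_alg_ring Quot I\<^esub> Y) w = act X (act Y w)"
      unfolding X hom(2)[symmetric] using w
      by (simp add: act alg_op_mult[where T=T, OF lin] alg_op_invariant[where T=T, OF sub inv])
  next
    fix w assume w: "w \<in> W"
    show "act \<one>\<^bsub>free_alg_ring Quot I\<^esub> w = w"
      unfolding hom(3)[symmetric] using w by (simp add: act)
    show "act (?c (fscalar c)) w = c *s w" for c using w by (simp add: act)
  qed
  with act show ?thesis by blast
qed


section \<open>Block diagonal matrices with blocks of size two\<close>

lemma diag_block_mat_pairs:
  assumes "\<And>i. i < n \<Longrightarrow> f i \<in> carrier_mat 2 2"
  shows "diag_block_mat (map f [0..<n]) \<in> carrier_mat (2 * n) (2 * n) \<and>
    (\<forall>a<2 * n. \<forall>b<2 * n. diag_block_mat (map f [0..<n]) $$ (a, b) =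
       (if a div 2 = b div 2 then f (a div 2) $$ (a mod 2, b mod 2) else 0))"
  using assms
proof (induction n)
  case 0
  then show ?case by simp
next
  case (Suc n)
  let ?A = "diag_block_mat (map f [0..<n])"
  have A: "?A \<in> carrier_mat (2 * n) (2 * n)"
    and e: "\<And>a b. a < 2 * n \<Longrightarrow> b < 2 * n \<Longrightarrow> ?A $$ (a, b) =
       (if a div 2 = b div 2 then f (a div 2) $$ (a mod 2, b mod 2) else 0)"
    using Suc by auto
  have f: "f n \<in> carrier_mat 2 2" using Suc.prems by simp
  have last: "a div 2 = n \<and> a mod 2 = a - 2 * n" if "2 * n \<le> a" "a < 2 * Suc n" for a
    using that by presburger
  have first: "a div 2 < n" if "a < 2 * n" for a using that by auto
  have "diag_block_mat (map f [0..<Suc n])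
      = four_block_mat ?A (0\<^sub>m (2 * n) 2) (0\<^sub>m 2 (2 * n)) (f n)"
    using A f by (auto simp: diag_block_mat_last Let_def)
  then have eq: "diag_block_mat (map f [0..<Suc n]) \<in> carrier_mat (2 * Suc n) (2 * Suc n)"
    "\<And>a b. a < 2 * Suc n \<Longrightarrow> b < 2 * Suc n \<Longrightarrow> diag_block_mat (map f [0..<Suc n]) $$ (a, b) =
      (if a < 2 * n then if b < 2 * n then ?A $$ (a, b) else 0
       else if b < 2 * n then 0 else f n $$ (a - 2 * n, b - 2 * n))"
    using A f by auto
  show ?case
  proof (intro conjI allI impI)
    show "diag_block_mat (map f [0..<Suc n]) \<in> carrier_mat (2 * Suc n) (2 * Suc n)" by (rule eq(1))
    fix a b assume ab: "a < 2 * Suc n" "b < 2 * Suc n"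
    show "diag_block_mat (map f [0..<Suc n]) $$ (a, b) =
       (if a div 2 = b div 2 then f (a div 2) $$ (a mod 2, b mod 2) else 0)"
      unfolding eq(2)[OF ab] using last[OF _ ab(1)] last[OF _ ab(2)] first[of a] first[of b]
      by (cases "a < 2 * n"; cases "b < 2 * n") (simp_all add: e)
  qed
qed

text \<open>The same with an additional block of size one at either end.\<close>

lemma diag_block_mat_shifted_pairs:
  assumes "f 0 \<in> carrier_mat 1 1" "f (Suc n) \<in> carrier_mat 1 1"
    and "\<And>i. 0 < i \<Longrightarrow> i \<le> n \<Longrightarrow> f i \<in> carrier_mat 2 2"
  shows "diag_block_mat (map f [0..<Suc (Suc n)]) \<in> carrier_mat (2 * Suc n) (2 * Suc n)"
    and "\<And>a b. a < 2 * Suc n \<Longrightarrow> b < 2 * Suc n \<Longrightarrow>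
       diag_block_mat (map f [0..<Suc (Suc n)]) $$ (a, b) =
       (if Suc a div 2 = Suc b div 2
        then f (Suc a div 2) $$ (if a = 0 then 0 else Suc a mod 2, if b = 0 then 0 else Suc b mod 2)
        else 0)"
proof -
  let ?M = "diag_block_mat (map (\<lambda>i. f (Suc i)) [0..<n])"
  have M: "?M \<in> carrier_mat (2 * n) (2 * n)"
    and e: "\<And>a b. a < 2 * n \<Longrightarrow> b < 2 * n \<Longrightarrow> ?M $$ (a, b) =
       (if a div 2 = b div 2 then f (Suc (a div 2)) $$ (a mod 2, b mod 2) else 0)"
    using diag_block_mat_pairs[of n "\<lambda>i. f (Suc i)"] assms(3) by auto
  have l: "map f [0..<Suc (Suc n)] = f 0 # map (\<lambda>i. f (Suc i)) [0..<n] @ [f (Suc n)]"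
  proof -
    have "[0..<Suc n] = 0 # map Suc [0..<n]"
      by (simp only: map_Suc_upt) (simp add: upt_conv_Cons del: upt_Suc)
    then show ?thesis by simp
  qed
  have eq: "diag_block_mat (map f [0..<Suc (Suc n)]) =
     four_block_mat (f 0) (0\<^sub>m 1 (2 * n + 1)) (0\<^sub>m (2 * n + 1) 1)
       (four_block_mat ?M (0\<^sub>m (2 * n) 1) (0\<^sub>m 1 (2 * n)) (f (Suc n)))"
    unfolding l using M assms(1,2) by (auto simp: diag_block_mat_last Let_def)
  show "diag_block_mat (map f [0..<Suc (Suc n)]) \<in> carrier_mat (2 * Suc n) (2 * Suc n)"
    unfolding eq using M assms(1,2) by auto
  fix a b assume ab: "a < 2 * Suc n" "b < 2 * Suc n"
  have split: "a = 0 \<or> (\<exists>a'. a = Suc a' \<and> a' < 2 * n \<and> a' div 2 < n) \<or> a = Suc (2 * n)"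
    if "a < 2 * Suc n" for a
    using that by (cases a) auto
  show "diag_block_mat (map f [0..<Suc (Suc n)]) $$ (a, b) =
       (if Suc a div 2 = Suc b div 2
        then f (Suc a div 2) $$ (if a = 0 then 0 else Suc a mod 2, if b = 0 then 0 else Suc b mod 2)
        else 0)"
    unfolding eq using split[OF ab(1)] split[OF ab(2)] M assms(1,2)
    by (elim disjE exE conjE) (simp_all add: e)
qed

lemma sum_of_two:
  assumes "finite S" "i \<in> S" "j \<in> S" "i \<noteq> j" "\<And>a. a \<in> S \<Longrightarrow> a \<noteq> i \<Longrightarrow> a \<noteq> j \<Longrightarrow> g a = 0"
  shows "sum g S = g i + (g j :: 'a::comm_monoid_add)"
proof -
  have "sum g S = sum g {i, j}"
    by (rule sum.mono_neutral_right) (use assms in auto)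
  then show ?thesis using assms by simp
qed

lemma column_pair:
  fixes w :: "nat \<Rightarrow> complex^'v::finite"
  assumes "\<And>i. i < d \<Longrightarrow> f i \<in> carrier_mat 2 2"
    and t: "\<And>j. j < 2 * d \<Longrightarrow> t (w j) = (\<Sum>a<2 * d. diag_block_mat (map f [0..<d]) $$ (a, j) *s w a)"
    and "i < d"
  shows "t (w (2 * i)) = f i $$ (0, 0) *s w (2 * i) + f i $$ (1, 0) *s w (2 * i + 1)"
    and "t (w (2 * i + 1)) = f i $$ (0, 1) *s w (2 * i) + f i $$ (1, 1) *s w (2 * i + 1)"
proof -
  have e: "diag_block_mat (map f [0..<d]) $$ (a, b) =
       (if a div 2 = b div 2 then f (a div 2) $$ (a mod 2, b mod 2) else 0)"
    if "a < 2 * d" "b < 2 * d" for a b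
    using diag_block_mat_pairs[of d f] assms(1) that by blast
  have z: "a div 2 \<noteq> i" if "a \<noteq> 2 * i" "a \<noteq> 2 * i + 1" for a
    using that by auto
  have s: "(\<Sum>a<2 * d. diag_block_mat (map f [0..<d]) $$ (a, b) *s w a)
    = diag_block_mat (map f [0..<d]) $$ (2 * i, b) *s w (2 * i)
      + diag_block_mat (map f [0..<d]) $$ (2 * i + 1, b) *s w (2 * i + 1)"
    if "b = 2 * i \<or> b = 2 * i + 1" for b
    by (rule sum_of_two) (use assms(3) z that in \<open>auto simp: e\<close>)
  show "t (w (2 * i)) = f i $$ (0, 0) *s w (2 * i) + f i $$ (1, 0) *s w (2 * i + 1)"
    "t (w (2 * i + 1)) = f i $$ (0, 1) *s w (2 * i) + f i $$ (1, 1) *s w (2 * i + 1)"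
  proof -
    have "2 * i < 2 * d" "2 * i + 1 < 2 * d" using assms(3) by auto
    note b = this
    show "t (w (2 * i)) = f i $$ (0, 0) *s w (2 * i) + f i $$ (1, 0) *s w (2 * i + 1)"
      unfolding t[OF b(1)] s[OF disjI1[OF refl]] using b by (simp add: e)
    show "t (w (2 * i + 1)) = f i $$ (0, 1) *s w (2 * i) + f i $$ (1, 1) *s w (2 * i + 1)"
      unfolding t[OF b(2)] s[OF disjI2[OF refl]] using b by (simp add: e)
  qed
qed

lemma column_shifted_pair:
  fixes w :: "nat \<Rightarrow> complex^'v::finite"
  assumes f: "f 0 \<in> carrier_mat 1 1" "f d \<in> carrier_mat 1 1"
      "\<forall>i. 0 < i \<longrightarrow> i < d \<longrightarrow> f i \<in> carrier_mat 2 2"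
    and t: "\<forall>j<2 * d. t (w j) = (\<Sum>a<2 * d. diag_block_mat (map f [0..<d + 1]) $$ (a, j) *s w a)"
    and "0 < d"
  shows "t (w 0) = f 0 $$ (0, 0) *s w 0"
    and "t (w (2 * d - 1)) = f d $$ (0, 0) *s w (2 * d - 1)"
    and "\<And>i. 0 < i \<Longrightarrow> i < d \<Longrightarrow>
      t (w (2 * i - 1)) = f i $$ (0, 0) *s w (2 * i - 1) + f i $$ (1, 0) *s w (2 * i)"
    and "\<And>i. 0 < i \<Longrightarrow> i < d \<Longrightarrow>
      t (w (2 * i)) = f i $$ (0, 1) *s w (2 * i - 1) + f i $$ (1, 1) *s w (2 * i)"
proof -
  obtain n where n: "d = Suc n" using \<open>0 < d\<close> by (cases d) auto
  define N where "N = diag_block_mat (map f [0..<d + 1])"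
  note t = t[rule_format, folded N_def]
  have e: "N $$ (a, b) =
       (if Suc a div 2 = Suc b div 2
        then f (Suc a div 2) $$ (if a = 0 then 0 else Suc a mod 2, if b = 0 then 0 else Suc b mod 2)
        else 0)"
    if "a < 2 * d" "b < 2 * d" for a b
    using diag_block_mat_shifted_pairs(2)[of f n a b] f that unfolding n N_def by simp
  have one: "(\<Sum>a<2 * d. N $$ (a, b) *s w a) = N $$ (b, b) *s w b" if "b = 0 \<or> b = 2 * d - 1" for b
  proof -
    have "(\<Sum>a<2 * d. N $$ (a, b) *s w a) = (\<Sum>a\<in>{b}. N $$ (a, b) *s w a)"
    proof (rule sum.mono_neutral_right)
      show "\<forall>a\<in>{..<2 * d} - {b}. N $$ (a, b) *s w a = 0"
      proof
        fix a assume a: "a \<in> {..<2 * d} - {b}"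
        then have "Suc a div 2 \<noteq> Suc b div 2" using that \<open>0 < d\<close> by auto
        then show "N $$ (a, b) *s w a = 0" using a that \<open>0 < d\<close> by (auto simp: e)
      qed
    qed (use that \<open>0 < d\<close> in auto)
    then show ?thesis by simp
  qed
  have b: "0 < 2 * d" "2 * d - 1 < 2 * d" using \<open>0 < d\<close> by auto
  show "t (w 0) = f 0 $$ (0, 0) *s w 0"
    unfolding t[OF b(1)] one[OF disjI1[OF refl]] using b by (simp add: e)
  have "Suc (2 * d - 1) = 2 * d" using \<open>0 < d\<close> by simp
  then show "t (w (2 * d - 1)) = f d $$ (0, 0) *s w (2 * d - 1)"
    unfolding t[OF b(2)] one[OF disjI2[OF refl]] using b by (simp add: e)
  fix i assume i: "0 < i" "i < d"
  have z: "Suc a div 2 \<noteq> i" if "a \<noteq> 2 * i - 1" "a \<noteq> 2 * i" for a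
    using that i by auto
  have b: "2 * i - 1 < 2 * d" "2 * i < 2 * d" using i by auto
  have S: "Suc (2 * i - 1) = 2 * i" "2 * i - 1 \<noteq> 0" using i by auto
  have s: "(\<Sum>a<2 * d. N $$ (a, b) *s w a)
    = N $$ (2 * i - 1, b) *s w (2 * i - 1) + N $$ (2 * i, b) *s w (2 * i)"
    if "b = 2 * i - 1 \<or> b = 2 * i" for b
  proof (rule sum_of_two)
    fix a assume a: "a \<in> {..<2 * d}" "a \<noteq> 2 * i - 1" "a \<noteq> 2 * i"
    have "Suc b div 2 = i" using that i by auto
    then show "N $$ (a, b) *s w a = 0" using z[OF a(2,3)] a(1) that i by (auto simp: e)
  qed (use i in auto)
  show "t (w (2 * i - 1)) = f i $$ (0, 0) *s w (2 * i - 1) + f i $$ (1, 0) *s w (2 * i)"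
    "t (w (2 * i)) = f i $$ (0, 1) *s w (2 * i - 1) + f i $$ (1, 1) *s w (2 * i)"
    unfolding t[OF b(1)] t[OF b(2)] s[OF disjI1[OF refl]] s[OF disjI2[OF refl]]
    using i S b by (simp_all add: e)
qed


section \<open>Identities between the blocks\<close>

text \<open>The relations between the coefficients that enter the traces, determinants and products of the
  blocks.\<close>

lemma PR_coeff_relation:
  assumes "1 - ss * q ^ (2 * i + 2) \<noteq> 0"
  shows "P_coeff q ss r1 r2 i - ss * R_coeff q ss r1 r2 i = r1 * r2 - ss"
    and "1 - R_coeff q ss r1 r2 i + (q ^ (i + 1))\<^sup>2 * (P_coeff q ss r1 r2 i + ss)
      = q ^ (i + 1) * (r1 + r2)"
proof -
  define x where "x = q ^ (i + 1)"
  define P where "P = P_coeff q ss r1 r2 i"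
  define R where "R = R_coeff q ss r1 r2 i"
  have x2: "q ^ (2 * i + 2) = x\<^sup>2" unfolding x_def power_mult[symmetric] by (simp add: mult.commute)
  note D = assms[unfolded x2]
  have P: "P * (1 - ss * x\<^sup>2) = (r1 - ss * x) * (r2 - ss * x)"
    using D unfolding P_def P_coeff_def x2 x_def[symmetric] by simp
  have R: "R * (1 - ss * x\<^sup>2) = (1 - r1 * x) * (1 - r2 * x)"
    using D unfolding R_def R_coeff_def x2 x_def[symmetric] by simp
  \<comment> \<open>The qualified name is needed: unqualified, it denotes the method for the ring locales.\<close>
  have "(P - ss * R) * (1 - ss * x\<^sup>2) = P * (1 - ss * x\<^sup>2) - ss * (R * (1 - ss * x\<^sup>2))"
    by Groebner_Basis.algebra
  also have "\<dots> = (r1 * r2 - ss) * (1 - ss * x\<^sup>2)" unfolding P R by Groebner_Basis.algebra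
  finally have "(P - ss * R) * (1 - ss * x\<^sup>2) = (r1 * r2 - ss) * (1 - ss * x\<^sup>2)" .
  with D show "P_coeff q ss r1 r2 i - ss * R_coeff q ss r1 r2 i = r1 * r2 - ss"
    unfolding P_def R_def by simp
  have "(1 - R + x\<^sup>2 * (P + ss)) * (1 - ss * x\<^sup>2)
      = (1 + x\<^sup>2 * ss) * (1 - ss * x\<^sup>2) - R * (1 - ss * x\<^sup>2) + x\<^sup>2 * (P * (1 - ss * x\<^sup>2))"
    by Groebner_Basis.algebra
  also have "\<dots> = x * (r1 + r2) * (1 - ss * x\<^sup>2)" unfolding P R by Groebner_Basis.algebra
  finally have "(1 - R + x\<^sup>2 * (P + ss)) * (1 - ss * x\<^sup>2) = x * (r1 + r2) * (1 - ss * x\<^sup>2)" .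
  with D show "1 - R_coeff q ss r1 r2 i + (q ^ (i + 1))\<^sup>2 * (P_coeff q ss r1 r2 i + ss)
      = q ^ (i + 1) * (r1 + r2)"
    unfolding P_def R_def x_def by simp
qed

lemma UVZ_coeff_relation:
  assumes "1 - ss * q ^ (2 * i + 1) \<noteq> 0" "q \<noteq> 0"
  shows "q ^ i * U_coeff d q ss i + Z_coeff d q ss i = 1 - q powi (int i - int d)"
    and "V_coeff d q ss i + q ^ i * ss * q ^ (d + 1) * Z_coeff d q ss i = 1 - q ^ i"
    and "q ^ d * U_coeff d q ss i - V_coeff d q ss i = q ^ d - 1"
    and "q ^ i * U_coeff d q ss i * V_coeff d q ss i + (1 - V_coeff d q ss i) * (1 - Z_coeff d q ss i) = q ^ i"
proof -
  define y where "y = q ^ i"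
  define Q where "Q = q ^ d"
  define g where "g = q powi (int i - int d)"
  define U where "U = U_coeff d q ss i"
  define V where "V = V_coeff d q ss i"
  define Z where "Z = Z_coeff d q ss i"
  have g: "g * Q = y" unfolding g_def Q_def y_def using assms(2)
    by (simp add: power_int_diff)
  have E: "q ^ (2 * i + 1) = y\<^sup>2 * q" "q ^ (i + 1) = y * q" "q ^ (d + i + 1) = Q * y * q" "q ^ (d + 1) = Q * q"
    unfolding y_def Q_def by (simp_all add: power_add power2_eq_square mult_2 mult_2_right ac_simps)
  define D where "D = 1 - ss * (y\<^sup>2 * q)"
  have D: "D \<noteq> 0" using assms(1) unfolding D_def E .
  have U: "U * D = (1 - g) * (1 - ss * (y * q))"
    using D unfolding U_def U_coeff_def E D_def[symmetric] g_def by simp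
  have V: "V * D = (1 - y) * (1 - ss * (Q * y * q))"
    using D unfolding V_def V_coeff_def E D_def[symmetric] y_def[symmetric] by simp
  have Z: "Z * D = (1 - y) * (1 - g)"
    using D unfolding Z_def Z_coeff_def E D_def[symmetric] y_def[symmetric] g_def by simp
  have "(y * U + Z) * D = (1 - g) * D"
    using U Z D_def by Groebner_Basis.algebra
  with D show "q ^ i * U_coeff d q ss i + Z_coeff d q ss i = 1 - q powi (int i - int d)"
    unfolding y_def U_def Z_def g_def by simp
  have "(V + y * ss * (Q * q) * Z) * D = V * D + y * ss * (Q * q) * (Z * D)" by Groebner_Basis.algebra
  also have "\<dots> = (1 - y) * D" unfolding V Z unfolding D_def g[symmetric] by Groebner_Basis.algebra
  finally have "(V + y * ss * (Q * q) * Z) * D = (1 - y) * D" .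
  with D show "V_coeff d q ss i + q ^ i * ss * q ^ (d + 1) * Z_coeff d q ss i = 1 - q ^ i"
    unfolding E(4) y_def V_def Z_def by simp
  have "(Q * U - V) * D = Q * (U * D) - V * D" by Groebner_Basis.algebra
  also have "\<dots> = (Q - 1) * D" unfolding U V unfolding D_def g[symmetric] by Groebner_Basis.algebra
  finally have "(Q * U - V) * D = (Q - 1) * D" .
  with D show "q ^ d * U_coeff d q ss i - V_coeff d q ss i = q ^ d - 1"
    unfolding Q_def U_def V_def by simp
  have "(y * U * V + (1 - V) * (1 - Z)) * (D * D) = y * (U * D) * (V * D) + (D - V * D) * (D - Z * D)"
    by Groebner_Basis.algebra
  also have "\<dots> = y * (D * D)"
    unfolding U V Z unfolding D_def g[symmetric] by Groebner_Basis.algebra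
  finally show "q ^ i * U_coeff d q ss i * V_coeff d q ss i + (1 - V_coeff d q ss i) * (1 - Z_coeff d q ss i) = q ^ i"
    using D unfolding y_def U_def V_def Z_def by simp
qed

section \<open>The operators\<close>

text \<open>The Cayley-Hamilton theorem for a \<open>2\<times>2\<close> matrix of determinant one: the matrix plus its inverse
  is its trace.\<close>

lemma two_by_two_quadratic:
  fixes u v :: "complex^'v::finite"
  assumes lin: "Vector_Spaces.linear (*s) (*s) t"
    and u: "t u = a *s u + c *s v" and v: "t v = b *s u + e *s v"
    and det: "a * e - b * c = 1" and tr: "a + e = k"
  shows "t (t u) = k *s t u - u" "t (t v) = k *s t v - v"
proof -
  note l = vec.linear_add[OF lin] vec.linear_scale[OF lin]
  have uu: "t (t u) = (a * a + b * c) *s u + (a * c + e * c) *s v"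
    by (subst u, subst l, subst (1 2) l, subst u, subst v)
      (simp add: Finite_Cartesian_Product.vec_eq_iff algebra_simps)
  have vv: "t (t v) = (a * b + b * e) *s u + (b * c + e * e) *s v"
    by (subst v, subst l, subst (1 2) l, subst u, subst v)
      (simp add: Finite_Cartesian_Product.vec_eq_iff algebra_simps)
  have "a * a + b * c = k * a - 1" "a * c + e * c = k * c"
    "a * b + b * e = k * b" "b * c + e * e = k * e - 1"
    using det tr by Groebner_Basis.algebra+
  note coeffs = this
  show "t (t u) = k *s t u - u"
    unfolding uu unfolding u coeffs by (simp add: Finite_Cartesian_Product.vec_eq_iff algebra_simps)
  show "t (t v) = k *s t v - v"
    unfolding vv unfolding v coeffs by (simp add: Finite_Cartesian_Product.vec_eq_iff algebra_simps)
qed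

lemma two_by_two_product:
  fixes u v :: "complex^'v::finite"
  assumes lin: "Vector_Spaces.linear (*s) (*s) t"
    and u: "t u = a *s u + c *s v" and v: "t v = b *s u + e *s v"
  shows "t (x *s u + y *s v) = (a * x + b * y) *s u + (c * x + e * y) *s v"
  unfolding vec.linear_add[OF lin] vec.linear_scale[OF lin] u v
  by (simp add: Finite_Cartesian_Product.vec_eq_iff algebra_simps)

lemma t0_block_carrier: "t0_block qh ssh r1h r2h i \<in> carrier_mat 2 2"
  and t3_block_carrier: "t3_block qh ssh r1h r2h i \<in> carrier_mat 2 2"
  by (auto simp: t0_block_def t3_block_def Let_def mat_of_rows_list_def)

lemma t1_block_carrier:
    "t1_block d qh ssh i \<in> (if i = 0 \<or> i = d then carrier_mat 1 1 else carrier_mat 2 2)"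
  and t2_block_carrier:
    "t2_block d qh ssh i \<in> (if i = 0 \<or> i = d then carrier_mat 1 1 else carrier_mat 2 2)"
  by (auto simp: t1_block_def t2_block_def Let_def mat_of_rows_list_def)

lemma T_matrix_carrier:
  assumes "0 < d"
  shows "T_matrix d qh ssh r1h r2h n \<in> carrier_mat (2 * d) (2 * d)"
proof -
  obtain m where m: "d = Suc m" using assms by (cases d) auto
  have "diag_block_mat (map f [0..<d]) \<in> carrier_mat (2 * d) (2 * d)"
    if "\<And>i. f i \<in> carrier_mat 2 2" for f :: "nat \<Rightarrow> complex mat"
    using diag_block_mat_pairs[of d f] that by blast
  moreover have "diag_block_mat (map f [0..<d + 1]) \<in> carrier_mat (2 * d) (2 * d)"
    if "\<And>i. f i \<in> (if i = 0 \<or> i = d then carrier_mat 1 1 else carrier_mat 2 2)"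
    for f :: "nat \<Rightarrow> complex mat"
  proof -
    have "f 0 \<in> carrier_mat 1 1" "f (Suc m) \<in> carrier_mat 1 1"
      using that[of 0] that[of "Suc m"] m by simp_all
    moreover have "f i \<in> carrier_mat 2 2" if "0 < i" "i \<le> m" for i
      using \<open>\<And>i. f i \<in> _\<close>[of i] that m by simp
    ultimately show ?thesis using diag_block_mat_shifted_pairs(1)[of f m] m by simp
  qed
  ultimately show ?thesis
    unfolding T_matrix_def
    using t0_block_carrier t1_block_carrier t2_block_carrier t3_block_carrier by simp
qed

text \<open>The scalar by which \<open>t\<^sub>n + t\<^sub>n\<^sup>-\<^sup>1\<close> acts: the common trace of the blocks of size two. A block of
  size one is a root of the same quadratic polynomial.\<close>

definition central_value :: "nat \<Rightarrow> complex \<Rightarrow> complex \<Rightarrow> complex \<Rightarrow> complex \<Rightarrow> 4 \<Rightarrow> complex" where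
  "central_value d qh ssh r1h r2h n =
    (let \<rho> = r1h * r2h; \<kappa> = ssh * qh ^ (d + 1)
     in if n = 0 then ssh / \<rho> + \<rho> / ssh else if n = 1 then qh ^ d + inverse (qh ^ d)
        else if n = 2 then \<kappa> + inverse \<kappa> else (r1h\<^sup>2 + r2h\<^sup>2) / \<rho>)"

context
  fixes w :: "nat \<Rightarrow> complex^'v::finite" and t :: "4 \<Rightarrow> complex^'v \<Rightarrow> complex^'v"
    and d :: nat and qh ssh r1h r2h :: complex
  assumes lin: "\<And>n. Vector_Spaces.linear (*s) (*s) (t n)"
    and t: "\<And>n j. j < 2 * d \<Longrightarrow>
      t n (w j) = (\<Sum>a<2 * d. T_matrix d qh ssh r1h r2h n $$ (a, j) *s w a)"
    and d: "0 < d" and nz: "qh \<noteq> 0" "ssh \<noteq> 0" "r1h \<noteq> 0" "r2h \<noteq> 0"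
    and ss: "\<And>k. 2 \<le> k \<Longrightarrow> k \<le> 2 * d \<Longrightarrow> ssh\<^sup>2 * (qh\<^sup>2) ^ k \<noteq> 1"
begin

abbreviation (input) "Pc \<equiv> P_coeff (qh\<^sup>2) (ssh\<^sup>2) (r1h\<^sup>2) (r2h\<^sup>2)"
abbreviation (input) "Rc \<equiv> R_coeff (qh\<^sup>2) (ssh\<^sup>2) (r1h\<^sup>2) (r2h\<^sup>2)"
abbreviation (input) "Uc \<equiv> U_coeff d (qh\<^sup>2) (ssh\<^sup>2)"
abbreviation (input) "Vc \<equiv> V_coeff d (qh\<^sup>2) (ssh\<^sup>2)"
abbreviation (input) "Zc \<equiv> Z_coeff d (qh\<^sup>2) (ssh\<^sup>2)"

lemma t0_column:
  assumes "i < d"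
  shows "t 0 (w (2 * i)) = ((Pc i + ssh\<^sup>2) / (ssh * (r1h * r2h))) *s w (2 * i)
      + (Pc i / (ssh * (r1h * r2h))) *s w (2 * i + 1)"
    and "t 0 (w (2 * i + 1)) = (- (ssh / (r1h * r2h)) * Rc i) *s w (2 * i)
      + (ssh / (r1h * r2h) * (1 - Rc i)) *s w (2 * i + 1)"
  using column_pair[of d "t0_block qh ssh r1h r2h" "t 0" w i] t[of _ 0] assms
  by (simp_all add: T_matrix_def t0_block_carrier) (simp_all add: t0_block_def Let_def mat_of_rows_list_def)

lemma t3_column:
  assumes "i < d"
  shows "t 3 (w (2 * i)) = ((1 - Rc i) / ((qh\<^sup>2) ^ (i + 1) * (r1h * r2h))) *s w (2 * i)
      + (- ((qh\<^sup>2) ^ (i + 1) / (r1h * r2h)) * Pc i) *s w (2 * i + 1)"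
    and "t 3 (w (2 * i + 1)) = (Rc i / ((qh\<^sup>2) ^ (i + 1) * (r1h * r2h))) *s w (2 * i)
      + ((qh\<^sup>2) ^ (i + 1) / (r1h * r2h) * (Pc i + ssh\<^sup>2)) *s w (2 * i + 1)"
  using column_pair[of d "t3_block qh ssh r1h r2h" "t 3" w i] t[of _ 3] assms
  by (simp_all add: T_matrix_def t3_block_carrier) (simp_all add: t3_block_def Let_def mat_of_rows_list_def)

lemma t1_column:
  shows "t 1 (w 0) = inverse (qh ^ d) *s w 0"
    and "t 1 (w (2 * d - 1)) = inverse (qh ^ d) *s w (2 * d - 1)"
    and "0 < i \<Longrightarrow> i < d \<Longrightarrow> t 1 (w (2 * i - 1)) = (qh ^ d * Uc i + inverse (qh ^ d)) *s w (2 * i - 1)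
      + (inverse (qh ^ d) * Vc i) *s w (2 * i)"
    and "0 < i \<Longrightarrow> i < d \<Longrightarrow> t 1 (w (2 * i)) = (- (qh ^ d) * Uc i) *s w (2 * i - 1)
      + (inverse (qh ^ d) * (1 - Vc i)) *s w (2 * i)"
proof -
  have T: "T_matrix d qh ssh r1h r2h 1 = diag_block_mat (map (t1_block d qh ssh) [0..<d + 1])"
    by (simp add: T_matrix_def)
  have c: "t1_block d qh ssh 0 \<in> carrier_mat 1 1" "t1_block d qh ssh d \<in> carrier_mat 1 1"
    "\<forall>i. 0 < i \<longrightarrow> i < d \<longrightarrow> t1_block d qh ssh i \<in> carrier_mat 2 2"
    using t1_block_carrier[of d qh ssh] by (metis, metis, metis less_irrefl_nat)
  have "\<forall>j<2 * d. t 1 (w j)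
      = (\<Sum>a<2 * d. diag_block_mat (map (t1_block d qh ssh) [0..<d + 1]) $$ (a, j) *s w a)"
    using t[of _ 1] unfolding T by blast
  note col = column_shifted_pair[of "t1_block d qh ssh" d "t 1" w, OF c this d]
  show "t 1 (w 0) = inverse (qh ^ d) *s w 0"
    using col(1) d by (simp add: t1_block_def Let_def mat_of_rows_list_def)
  show "t 1 (w (2 * d - 1)) = inverse (qh ^ d) *s w (2 * d - 1)"
    using col(2) d by (simp add: t1_block_def Let_def mat_of_rows_list_def)
  show "t 1 (w (2 * i - 1)) = (qh ^ d * Uc i + inverse (qh ^ d)) *s w (2 * i - 1)
      + (inverse (qh ^ d) * Vc i) *s w (2 * i)" if "0 < i" "i < d"
    using col(3)[OF that] that by (simp add: t1_block_def Let_def mat_of_rows_list_def)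
  show "t 1 (w (2 * i)) = (- (qh ^ d) * Uc i) *s w (2 * i - 1)
      + (inverse (qh ^ d) * (1 - Vc i)) *s w (2 * i)" if "0 < i" "i < d"
    using col(4)[OF that] that by (simp add: t1_block_def Let_def mat_of_rows_list_def)
qed

lemma t2_column:
  defines "\<kappa> \<equiv> ssh * qh ^ (d + 1)"
  shows "t 2 (w 0) = \<kappa> *s w 0"
    and "t 2 (w (2 * d - 1)) = inverse \<kappa> *s w (2 * d - 1)"
    and "0 < i \<Longrightarrow> i < d \<Longrightarrow> t 2 (w (2 * i - 1)) = ((\<kappa>\<^sup>2 * Zc i + 1) / \<kappa>) *s w (2 * i - 1)
      + (- (Vc i / ((qh\<^sup>2) ^ i * \<kappa>))) *s w (2 * i)"
    and "0 < i \<Longrightarrow> i < d \<Longrightarrow> t 2 (w (2 * i)) = ((qh\<^sup>2) ^ i * \<kappa> * Uc i) *s w (2 * i - 1)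
      + (\<kappa> * (1 - Zc i)) *s w (2 * i)"
proof -
  have T: "T_matrix d qh ssh r1h r2h 2 = diag_block_mat (map (t2_block d qh ssh) [0..<d + 1])"
    by (simp add: T_matrix_def)
  have c: "t2_block d qh ssh 0 \<in> carrier_mat 1 1" "t2_block d qh ssh d \<in> carrier_mat 1 1"
    "\<forall>i. 0 < i \<longrightarrow> i < d \<longrightarrow> t2_block d qh ssh i \<in> carrier_mat 2 2"
    using t2_block_carrier[of d qh ssh] by (metis, metis, metis less_irrefl_nat)
  have "\<forall>j<2 * d. t 2 (w j)
      = (\<Sum>a<2 * d. diag_block_mat (map (t2_block d qh ssh) [0..<d + 1]) $$ (a, j) *s w a)"
    using t[of _ 2] unfolding T by blast
  note col = column_shifted_pair[of "t2_block d qh ssh" d "t 2" w, OF c this d]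
  show "t 2 (w 0) = \<kappa> *s w 0"
    using col(1) d by (simp add: t2_block_def Let_def mat_of_rows_list_def \<kappa>_def)
  show "t 2 (w (2 * d - 1)) = inverse \<kappa> *s w (2 * d - 1)"
    using col(2) d by (simp add: t2_block_def Let_def mat_of_rows_list_def \<kappa>_def)
  show "t 2 (w (2 * i - 1)) = ((\<kappa>\<^sup>2 * Zc i + 1) / \<kappa>) *s w (2 * i - 1)
      + (- (Vc i / ((qh\<^sup>2) ^ i * \<kappa>))) *s w (2 * i)" if "0 < i" "i < d"
    using col(3)[OF that] that by (simp add: t2_block_def Let_def mat_of_rows_list_def \<kappa>_def)
  show "t 2 (w (2 * i)) = ((qh\<^sup>2) ^ i * \<kappa> * Uc i) *s w (2 * i - 1)
      + (\<kappa> * (1 - Zc i)) *s w (2 * i)" if "0 < i" "i < d"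
    using col(4)[OF that] that by (simp add: t2_block_def Let_def mat_of_rows_list_def \<kappa>_def)
qed

lemma den_nz:
  assumes "i < d"
  shows "1 - ssh\<^sup>2 * (qh\<^sup>2) ^ (2 * i + 2) \<noteq> 0"
    and "0 < i \<Longrightarrow> 1 - ssh\<^sup>2 * (qh\<^sup>2) ^ (2 * i + 1) \<noteq> 0"
  using ss[of "2 * i + 2"] ss[of "2 * i + 1"] assms by auto

lemma basis_cases:
  assumes "j < 2 * d"
  obtains i where "i < d" "j = 2 * i" | i where "i < d" "j = 2 * i + 1"
  using assms by (metis div_mod_decomp even_iff_mod_2_eq_zero less_mult_imp_div_less mult.commute odd_iff_mod_2_eq_one add_0_right)

lemma basis_cases_shifted:
  assumes "j < 2 * d"
  obtains "j = 0" | "j = 2 * d - 1" | i where "0 < i" "i < d" "j = 2 * i - 1"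
    | i where "0 < i" "i < d" "j = 2 * i"
proof -
  show thesis
  proof (cases "even j")
    case True
    then obtain i where "j = 2 * i" by (auto elim: evenE)
    then show thesis using that assms by (cases "i = 0") auto
  next
    case False
    then obtain i where "j = 2 * i + 1" by (auto elim: oddE)
    then show thesis using that(2) that(3)[of "i + 1"] assms by (cases "i + 1 = d") auto
  qed
qed

lemma operator_quadratic:
  assumes "j < 2 * d"
  shows "t n (t n (w j)) = central_value d qh ssh r1h r2h n *s t n (w j) - w j"
proof -
  have n4: "n = 0 \<or> n = 1 \<or> n = 2 \<or> n = 3" using exhaust_4[of n] by auto
  define \<rho> where "\<rho> = r1h * r2h"
  have \<rho>: "\<rho> \<noteq> 0" using nz by (simp add: \<rho>_def)
  have \<rho>2: "r1h\<^sup>2 * r2h\<^sup>2 = \<rho>\<^sup>2" by (simp add: \<rho>_def power_mult_distrib)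
  define \<kappa> where "\<kappa> = ssh * qh ^ (d + 1)"
  have \<kappa>: "\<kappa> \<noteq> 0" using nz by (simp add: \<kappa>_def)
  define Q where "Q = qh ^ d"
  have Q: "Q \<noteq> 0" using nz by (simp add: Q_def)
  have Q2: "(qh\<^sup>2) ^ d = Q\<^sup>2" by (simp add: Q_def flip: power_mult power_mult_distrib mult.commute)
  show ?thesis
    using n4
  proof (elim disjE)
    assume n: "n = 0"
    from assms obtain i where i: "i < d" "j = 2 * i \<or> j = 2 * i + 1" by (metis basis_cases)
    define P where "P = Pc i" define R where "R = Rc i"
    have PR: "P - ssh\<^sup>2 * R = \<rho>\<^sup>2 - ssh\<^sup>2"
      using PR_coeff_relation(1)[OF den_nz(1)[OF i(1)], of "r1h\<^sup>2" "r2h\<^sup>2"] by (simp add: P_def R_def \<rho>2)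
    have P: "P = ssh\<^sup>2 * R + \<rho>\<^sup>2 - ssh\<^sup>2" using PR by (simp add: algebra_simps)
    have c: "central_value d qh ssh r1h r2h 0 = ssh / \<rho> + \<rho> / ssh"
      by (simp add: central_value_def Let_def \<rho>_def)
    note col = t0_column[OF i(1), folded P_def R_def \<rho>_def]
    have det: "(P + ssh\<^sup>2) / (ssh * \<rho>) * (ssh / \<rho> * (1 - R)) - - (ssh / \<rho>) * R * (P / (ssh * \<rho>)) = 1"
      unfolding P using \<rho> nz by (simp add: field_simps power2_eq_square)
    have tr: "(P + ssh\<^sup>2) / (ssh * \<rho>) + ssh / \<rho> * (1 - R) = ssh / \<rho> + \<rho> / ssh"
      unfolding P using \<rho> nz by (simp add: field_simps power2_eq_square)
    note quad = two_by_two_quadratic[OF lin col det tr]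
    show ?thesis unfolding n c using i(2) quad by auto
  next
    assume n: "n = 3"
    from assms obtain i where i: "i < d" "j = 2 * i \<or> j = 2 * i + 1" by (metis basis_cases)
    define P where "P = Pc i" define R where "R = Rc i"
    define y where "y = (qh\<^sup>2) ^ (i + 1)"
    have y: "y \<noteq> 0" using nz by (simp add: y_def)
    have P: "P = ssh\<^sup>2 * R + \<rho>\<^sup>2 - ssh\<^sup>2"
      using PR_coeff_relation(1)[OF den_nz(1)[OF i(1)], of "r1h\<^sup>2" "r2h\<^sup>2"]
      by (simp add: P_def R_def \<rho>2 algebra_simps)
    have T: "1 - R + y\<^sup>2 * (P + ssh\<^sup>2) = y * (r1h\<^sup>2 + r2h\<^sup>2)"
      using PR_coeff_relation(2)[OF den_nz(1)[OF i(1)], of "r1h\<^sup>2" "r2h\<^sup>2"] unfolding P_def R_def y_def .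
    have c: "central_value d qh ssh r1h r2h 3 = (r1h\<^sup>2 + r2h\<^sup>2) / \<rho>"
      by (simp add: central_value_def Let_def \<rho>_def)
    note col = t3_column[OF i(1), folded P_def R_def \<rho>_def y_def]
    have det: "(1 - R) / (y * \<rho>) * (y / \<rho> * (P + ssh\<^sup>2)) - R / (y * \<rho>) * (- (y / \<rho>) * P) = 1"
      unfolding P using \<rho> nz y by (simp add: field_simps power2_eq_square)
    have "(1 - R) / (y * \<rho>) + y / \<rho> * (P + ssh\<^sup>2) = (1 - R + y\<^sup>2 * (P + ssh\<^sup>2)) / (y * \<rho>)"
      using \<rho> y by (simp add: field_simps power2_eq_square)
    also have "\<dots> = (r1h\<^sup>2 + r2h\<^sup>2) / \<rho>" unfolding T using \<rho> y by simp
    finally have tr: "(1 - R) / (y * \<rho>) + y / \<rho> * (P + ssh\<^sup>2) = (r1h\<^sup>2 + r2h\<^sup>2) / \<rho>" .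
    note quad = two_by_two_quadratic[OF lin col det tr]
    show ?thesis unfolding n c using i(2) quad by auto
  next
    assume n: "n = 1"
    have c: "central_value d qh ssh r1h r2h 1 = Q + inverse Q"
      by (simp add: central_value_def Let_def Q_def)
    have end_points: "t 1 (t 1 (w j)) = (Q + inverse Q) *s t 1 (w j) - w j"
      if "t 1 (w j) = inverse Q *s w j"
      unfolding that vec.linear_scale[OF lin] using Q
      by (simp add: Finite_Cartesian_Product.vec_eq_iff field_simps)
    from assms show ?thesis
    proof (cases rule: basis_cases_shifted)
      case 1
      have "t 1 (w j) = inverse Q *s w j" unfolding 1 Q_def by (rule t1_column(1))
      then show ?thesis unfolding n c by (rule end_points)
    next
      case 2
      have "t 1 (w j) = inverse Q *s w j" unfolding 2 Q_def by (rule t1_column(2))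
      then show ?thesis unfolding n c by (rule end_points)
    next
      case (3 i)
      define U where "U = Uc i" define V where "V = Vc i"
      have V: "V = Q\<^sup>2 * U - Q\<^sup>2 + 1"
        using UVZ_coeff_relation(3)[OF den_nz(2)[OF 3(2,1)], of d] nz
        unfolding U_def V_def Q2 by (simp add: algebra_simps)
      note col = t1_column(3,4)[OF 3(1,2), folded U_def V_def Q_def]
      have det: "(Q * U + inverse Q) * (inverse Q * (1 - V)) - - Q * U * (inverse Q * V) = 1"
        unfolding V using Q by (simp add: field_simps power2_eq_square)
      have tr: "Q * U + inverse Q + inverse Q * (1 - V) = Q + inverse Q"
        unfolding V using Q by (simp add: field_simps power2_eq_square)
      show ?thesis using two_by_two_quadratic(1)[OF lin col det tr] unfolding n c 3(3) .
    next
      case (4 i)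
      define U where "U = Uc i" define V where "V = Vc i"
      have V: "V = Q\<^sup>2 * U - Q\<^sup>2 + 1"
        using UVZ_coeff_relation(3)[OF den_nz(2)[OF 4(2,1)], of d] nz
        unfolding U_def V_def Q2 by (simp add: algebra_simps)
      note col = t1_column(3,4)[OF 4(1,2), folded U_def V_def Q_def]
      have det: "(Q * U + inverse Q) * (inverse Q * (1 - V)) - - Q * U * (inverse Q * V) = 1"
        unfolding V using Q by (simp add: field_simps power2_eq_square)
      have tr: "Q * U + inverse Q + inverse Q * (1 - V) = Q + inverse Q"
        unfolding V using Q by (simp add: field_simps power2_eq_square)
      show ?thesis using two_by_two_quadratic(2)[OF lin col det tr] unfolding n c 4(3) .
    qed
  next
    assume n: "n = 2"
    have c: "central_value d qh ssh r1h r2h 2 = \<kappa> + inverse \<kappa>"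
      by (simp add: central_value_def Let_def \<kappa>_def)
    have end_points: "t 2 (t 2 (w j)) = (\<kappa> + inverse \<kappa>) *s t 2 (w j) - w j"
      if "t 2 (w j) = x *s w j" "x = \<kappa> \<or> x = inverse \<kappa>" for x
    proof -
      have "x * x = (\<kappa> + inverse \<kappa>) * x - 1" using \<kappa> that(2) by (auto simp: field_simps)
      then show ?thesis unfolding that(1) vec.linear_scale[OF lin]
        by (simp add: vec.scale_left_diff_distrib)
    qed
    have quad: "t 2 (t 2 (w (2 * i - 1))) = (\<kappa> + inverse \<kappa>) *s t 2 (w (2 * i - 1)) - w (2 * i - 1)"
      "t 2 (t 2 (w (2 * i))) = (\<kappa> + inverse \<kappa>) *s t 2 (w (2 * i)) - w (2 * i)"
      if i: "0 < i" "i < d" for i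
    proof -
      define U where "U = Uc i" define V where "V = Vc i" define Z where "Z = Zc i"
      define y where "y = (qh\<^sup>2) ^ i"
      have y: "y \<noteq> 0" using nz by (simp add: y_def)
      have \<kappa>2: "\<kappa>\<^sup>2 = ssh\<^sup>2 * (qh\<^sup>2) ^ (d + 1)"
        unfolding \<kappa>_def power_mult_distrib by (simp only: mult.commute flip: power_mult)
      have VZ: "V + y * \<kappa>\<^sup>2 * Z = 1 - y"
        using UVZ_coeff_relation(2)[OF den_nz(2)[OF i(2,1)], of d] nz
        unfolding \<kappa>2 V_def Z_def y_def by (simp add: mult.assoc)
      have UV: "y * U * V + (1 - V) * (1 - Z) = y"
        using UVZ_coeff_relation(4)[OF den_nz(2)[OF i(2,1)], of d] nz
        unfolding U_def V_def Z_def y_def by simp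
      note col = t2_column(3,4)[OF i, folded U_def V_def Z_def y_def \<kappa>_def]
      have "y * ((\<kappa>\<^sup>2 * Z + 1) * (1 - Z) + U * V) = y"
        using VZ UV by Groebner_Basis.algebra
      then have *: "(\<kappa>\<^sup>2 * Z + 1) * (1 - Z) + U * V = 1" using y by simp
      have "(\<kappa>\<^sup>2 * Z + 1) / \<kappa> * (\<kappa> * (1 - Z)) - y * \<kappa> * U * - (V / (y * \<kappa>))
         = (\<kappa>\<^sup>2 * Z + 1) * (1 - Z) + U * V"
        using y \<kappa> by (simp add: field_simps)
      with * have det: "(\<kappa>\<^sup>2 * Z + 1) / \<kappa> * (\<kappa> * (1 - Z)) - y * \<kappa> * U * - (V / (y * \<kappa>)) = 1"
        by simp
      have tr: "(\<kappa>\<^sup>2 * Z + 1) / \<kappa> + \<kappa> * (1 - Z) = \<kappa> + inverse \<kappa>"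
        using \<kappa> by (simp add: field_simps power2_eq_square)
      show "t 2 (t 2 (w (2 * i - 1))) = (\<kappa> + inverse \<kappa>) *s t 2 (w (2 * i - 1)) - w (2 * i - 1)"
        "t 2 (t 2 (w (2 * i))) = (\<kappa> + inverse \<kappa>) *s t 2 (w (2 * i)) - w (2 * i)"
        using two_by_two_quadratic[OF lin col det tr] by simp_all
    qed
    from assms show ?thesis unfolding n c
    proof (cases rule: basis_cases_shifted)
      case 1
      have "t 2 (w j) = \<kappa> *s w j" unfolding 1 \<kappa>_def by (rule t2_column(1))
      then show "t 2 (t 2 (w j)) = (\<kappa> + inverse \<kappa>) *s t 2 (w j) - w j"
        using end_points by blast
    next
      case 2
      have "t 2 (w j) = inverse \<kappa> *s w j" unfolding 2 \<kappa>_def by (rule t2_column(2))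
      then show "t 2 (t 2 (w j)) = (\<kappa> + inverse \<kappa>) *s t 2 (w j) - w j"
        using end_points by blast
    qed (use quad in auto)
  qed
qed

text \<open>The blocks of \<open>t\<^sub>1\<close> and \<open>t\<^sub>2\<close> straddle those of \<open>t\<^sub>0\<close> and \<open>t\<^sub>3\<close>. The product
  \<open>t\<^sub>0 t\<^sub>1 t\<^sub>2 t\<^sub>3\<close> can nevertheless be computed inside the latter, since \<open>t\<^sub>1 t\<^sub>2\<close> is diagonal.\<close>

lemma t1_t2_diagonal:
  shows "i < d \<Longrightarrow> t 1 (t 2 (w (2 * i))) = (ssh * (qh\<^sup>2) ^ i * qh) *s w (2 * i)"
    and "i < d \<Longrightarrow> t 1 (t 2 (w (2 * i + 1))) = inverse (ssh * (qh\<^sup>2) ^ (i + 1) * qh) *s w (2 * i + 1)"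
proof -
  define \<kappa> where "\<kappa> = ssh * qh ^ (d + 1)"
  have \<kappa>: "\<kappa> \<noteq> 0" using nz by (simp add: \<kappa>_def)
  define Q where "Q = qh ^ d"
  have Q: "Q \<noteq> 0" using nz by (simp add: Q_def)
  have \<kappa>Q: "\<kappa> = ssh * Q * qh" by (simp add: \<kappa>_def Q_def)
  have Q2: "(qh\<^sup>2) ^ d = Q\<^sup>2" by (simp add: Q_def flip: power_mult power_mult_distrib mult.commute)
  have mid: "t 1 (t 2 (w (2 * i - 1))) = inverse (ssh * (qh\<^sup>2) ^ i * qh) *s w (2 * i - 1)"
      "t 1 (t 2 (w (2 * i))) = (ssh * (qh\<^sup>2) ^ i * qh) *s w (2 * i)"
    if i: "0 < i" "i < d" for i
  proof -
    define U where "U = Uc i" define V where "V = Vc i" define Z where "Z = Zc i"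
    define y where "y = (qh\<^sup>2) ^ i"
    have y: "y \<noteq> 0" using nz by (simp add: y_def)
    note rel = UVZ_coeff_relation[OF den_nz(2)[OF i(2,1)], of d]
    define g where "g = (qh\<^sup>2) powi (int i - int d)"
    have g: "g * Q\<^sup>2 = y" unfolding g_def y_def Q2[symmetric] using nz by (simp add: power_int_diff)
    have UZ: "y * U + Z = 1 - g" using rel(1) nz unfolding U_def Z_def y_def g_def by simp
    have \<kappa>2: "\<kappa>\<^sup>2 = ssh\<^sup>2 * (qh\<^sup>2) ^ (d + 1)"
      unfolding \<kappa>_def power_mult_distrib by (simp only: mult.commute flip: power_mult)
    have VZ: "V + y * \<kappa>\<^sup>2 * Z = 1 - y"
      using rel(2) nz unfolding \<kappa>2 V_def Z_def y_def by (simp add: mult.assoc)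
    have UV: "Q\<^sup>2 * U - V = Q\<^sup>2 - 1" using rel(3) nz unfolding U_def V_def Q2 by simp
    have UVZ: "y * U * V + (1 - V) * (1 - Z) = y" using rel(4) nz unfolding U_def V_def Z_def y_def by simp
    note col1 = t1_column(3,4)[OF i, folded U_def V_def Q_def]
    note col2 = t2_column(3,4)[OF i, folded U_def V_def Z_def y_def \<kappa>_def]
    have a: "(Q * U + inverse Q) * ((\<kappa>\<^sup>2 * Z + 1) / \<kappa>) + - Q * U * - (V / (y * \<kappa>)) = inverse (ssh * y * qh)"
    proof -
      have "y * ((Q\<^sup>2 * U + 1) * (\<kappa>\<^sup>2 * Z + 1)) + Q\<^sup>2 * U * V = Q\<^sup>2"
      proof -
        have "Q\<^sup>2 * U + 1 = Q\<^sup>2 + V" "Q\<^sup>2 * U = Q\<^sup>2 - 1 + V" "y * (\<kappa>\<^sup>2 * Z + 1) = 1 - V"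
          using UV VZ by (simp_all add: algebra_simps)
        then show ?thesis by Groebner_Basis.algebra
      qed
      then show ?thesis unfolding \<kappa>Q using nz Q y by (simp add: field_simps power2_eq_square)
    qed
    have b: "inverse Q * V * ((\<kappa>\<^sup>2 * Z + 1) / \<kappa>) + inverse Q * (1 - V) * - (V / (y * \<kappa>)) = 0"
    proof -
      have "inverse Q * V * ((\<kappa>\<^sup>2 * Z + 1) / \<kappa>) + inverse Q * (1 - V) * - (V / (y * \<kappa>))
        = V * (V + y * \<kappa>\<^sup>2 * Z - (1 - y)) / (Q * \<kappa> * y)"
        using Q \<kappa> y by (simp add: field_simps)
      then show ?thesis unfolding VZ by simp
    qed
    have c: "(Q * U + inverse Q) * (y * \<kappa> * U) + - Q * U * (\<kappa> * (1 - Z)) = 0"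
    proof -
      have "(Q * U + inverse Q) * (y * \<kappa> * U) + - Q * U * (\<kappa> * (1 - Z))
        = U * \<kappa> * (Q\<^sup>2 * (y * U + Z) + y - Q\<^sup>2) / Q"
        using Q by (simp add: field_simps power2_eq_square)
      also have "\<dots> = 0" unfolding UZ unfolding g[symmetric] by (simp add: algebra_simps)
      finally show ?thesis .
    qed
    have e: "inverse Q * V * (y * \<kappa> * U) + inverse Q * (1 - V) * (\<kappa> * (1 - Z)) = ssh * y * qh"
    proof -
      have "inverse Q * V * (y * \<kappa> * U) + inverse Q * (1 - V) * (\<kappa> * (1 - Z))
         = \<kappa> / Q * (y * U * V + (1 - V) * (1 - Z))"
        using Q by (simp add: field_simps)
      also have "\<dots> = ssh * y * qh" unfolding UVZ \<kappa>Q using Q by simp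
      finally show ?thesis .
    qed
    show "t 1 (t 2 (w (2 * i - 1))) = inverse (ssh * (qh\<^sup>2) ^ i * qh) *s w (2 * i - 1)"
      unfolding y_def[symmetric] col2(1) two_by_two_product[OF lin col1] a b by simp
    show "t 1 (t 2 (w (2 * i))) = (ssh * (qh\<^sup>2) ^ i * qh) *s w (2 * i)"
      unfolding y_def[symmetric] col2(2) two_by_two_product[OF lin col1] c e by simp
  qed
  show "t 1 (t 2 (w (2 * i))) = (ssh * (qh\<^sup>2) ^ i * qh) *s w (2 * i)" if "i < d"
  proof (cases "i = 0")
    case True
    then show ?thesis
      using t1_column(1) t2_column(1) vec.linear_scale[OF lin, of 1] nz by (simp add: field_simps)
  next
    case False
    then show ?thesis using mid(2) that by simp
  qed
  show "t 1 (t 2 (w (2 * i + 1))) = inverse (ssh * (qh\<^sup>2) ^ (i + 1) * qh) *s w (2 * i + 1)" if "i < d"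
  proof (cases "i + 1 = d")
    case True
    then have "2 * i + 1 = 2 * d - 1" by auto
    moreover have "t 1 (t 2 (w (2 * d - 1))) = (inverse \<kappa> * inverse Q) *s w (2 * d - 1)"
      unfolding t2_column(2) vec.linear_scale[OF lin] t1_column(2) by (simp add: \<kappa>_def Q_def)
    moreover have "inverse \<kappa> * inverse Q = inverse (ssh * (qh\<^sup>2) ^ (i + 1) * qh)"
      unfolding True Q2 \<kappa>Q using nz Q by (simp add: field_simps power2_eq_square)
    ultimately show ?thesis by simp
  next
    case False
    then show ?thesis using mid(1)[of "i + 1"] that by simp
  qed
qed

lemma operator_product:
  assumes "j < 2 * d"
  shows "t 0 (t 1 (t 2 (t 3 (w j)))) = inverse qh *s w j"
proof -
  from assms obtain i where i: "i < d" "j = 2 * i \<or> j = 2 * i + 1" by (metis basis_cases)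
  define P where "P = Pc i" define R where "R = Rc i"
  define \<rho> where "\<rho> = r1h * r2h"
  have \<rho>: "\<rho> \<noteq> 0" using nz by (simp add: \<rho>_def)
  have \<rho>2: "r1h\<^sup>2 * r2h\<^sup>2 = \<rho>\<^sup>2" by (simp add: \<rho>_def power_mult_distrib)
  define y where "y = (qh\<^sup>2) ^ (i + 1)"
  have y: "y \<noteq> 0" using nz by (simp add: y_def)
  have yi: "ssh * (qh\<^sup>2) ^ i * qh = ssh * y / qh"
    using nz by (simp add: y_def power2_eq_square)
  have P: "P = ssh\<^sup>2 * R + \<rho>\<^sup>2 - ssh\<^sup>2"
    using PR_coeff_relation(1)[OF den_nz(1)[OF i(1)], of "r1h\<^sup>2" "r2h\<^sup>2"]
    by (simp add: P_def R_def \<rho>2 algebra_simps)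
  note col0 = t0_column[OF i(1), folded P_def R_def \<rho>_def]
  note col3 = t3_column[OF i(1), folded P_def R_def \<rho>_def y_def]
  note mid = t1_t2_diagonal[OF i(1), folded y_def, unfolded yi]
  have step: "t 0 (t 1 (t 2 (a *s w (2 * i) + b *s w (2 * i + 1)))) =
     ((P + ssh\<^sup>2) / (ssh * \<rho>) * (a * (ssh * y / qh)) + - (ssh / \<rho>) * R * (b * inverse (ssh * y * qh))) *s w (2 * i)
     + (P / (ssh * \<rho>) * (a * (ssh * y / qh)) + ssh / \<rho> * (1 - R) * (b * inverse (ssh * y * qh))) *s w (2 * i + 1)"
    for a b
  proof -
    have "t 1 (t 2 (a *s w (2 * i) + b *s w (2 * i + 1)))
       = (a * (ssh * y / qh)) *s w (2 * i) + (b * inverse (ssh * y * qh)) *s w (2 * i + 1)"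
      by (simp only: vec.linear_add[OF lin] vec.linear_scale[OF lin] mid vec.scale_scale)
    then show ?thesis by (simp only: two_by_two_product[OF lin col0])
  qed
  have "t 0 (t 1 (t 2 (t 3 (w (2 * i))))) = inverse qh *s w (2 * i)"
  proof -
    have "(P + ssh\<^sup>2) / (ssh * \<rho>) * ((1 - R) / (y * \<rho>) * (ssh * y / qh))
        + - (ssh / \<rho>) * R * (- (y / \<rho>) * P * inverse (ssh * y * qh)) = inverse qh"
      unfolding P using nz \<rho> y by (simp add: field_simps power2_eq_square)
    moreover have "P / (ssh * \<rho>) * ((1 - R) / (y * \<rho>) * (ssh * y / qh))
        + ssh / \<rho> * (1 - R) * (- (y / \<rho>) * P * inverse (ssh * y * qh)) = 0"
      using nz \<rho> y by (simp add: field_simps)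
    ultimately show ?thesis unfolding col3(1) step by simp
  qed
  moreover have "t 0 (t 1 (t 2 (t 3 (w (2 * i + 1))))) = inverse qh *s w (2 * i + 1)"
  proof -
    have "(P + ssh\<^sup>2) / (ssh * \<rho>) * (R / (y * \<rho>) * (ssh * y / qh))
        + - (ssh / \<rho>) * R * (y / \<rho> * (P + ssh\<^sup>2) * inverse (ssh * y * qh)) = 0"
      using nz \<rho> y by (simp add: field_simps)
    moreover have "P / (ssh * \<rho>) * (R / (y * \<rho>) * (ssh * y / qh))
        + ssh / \<rho> * (1 - R) * (y / \<rho> * (P + ssh\<^sup>2) * inverse (ssh * y * qh)) = inverse qh"
      unfolding P using nz \<rho> y by (simp add: field_simps power2_eq_square)
    ultimately show ?thesis unfolding col3(2) step by simp
  qed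
  ultimately show ?thesis using i(2) by auto
qed

end


section \<open>Distances in a connected graph\<close>

context
  fixes adj :: "'v::finite \<Rightarrow> 'v \<Rightarrow> bool"
  assumes conn: "simple_connected_graph adj"
begin

lemma relpowp_gdist: "(adj ^^ gdist adj y z) y z"
proof -
  have "adj\<^sup>*\<^sup>* y z" using conn by (simp add: simple_connected_graph_def)
  then obtain n where "(adj ^^ n) y z" by (auto dest: rtranclp_imp_relpowp)
  then show ?thesis unfolding gdist_def by (rule LeastI)
qed

lemma gdist_le: "(adj ^^ n) y z \<Longrightarrow> gdist adj y z \<le> n"
  unfolding gdist_def by (rule Least_le)

lemma gdist_eq_0 [simp]: "gdist adj y z = 0 \<longleftrightarrow> y = z"
  using relpowp_gdist[of y z] gdist_le[of 0 y z] by auto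

lemma gdist_commute: "gdist adj y z = gdist adj z y"
proof -
  have "(adj ^^ n) v u" if "(adj ^^ n) u v" for n u v
    using that
  proof (induction n arbitrary: v)
    case (Suc n)
    then obtain a where "(adj ^^ n) u a" "adj a v" by auto
    moreover have "adj v a" using conn \<open>adj a v\<close> by (auto simp: simple_connected_graph_def symp_def)
    ultimately show ?case using Suc.IH by (metis relpowp_Suc_I2)
  qed auto
  then show ?thesis by (meson antisym gdist_le relpowp_gdist)
qed

lemma gdist_triangle: "gdist adj y z \<le> gdist adj y u + gdist adj u z"
  by (rule gdist_le) (auto simp: relpowp_add intro: relcomppI relpowp_gdist)

lemma gdist_eq_1 [simp]: "gdist adj y z = Suc 0 \<longleftrightarrow> adj y z"
proof
  assume "gdist adj y z = Suc 0"
  then show "adj y z" using relpowp_gdist[of y z] by auto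
next
  assume a: "adj y z"
  then have "y \<noteq> z" using conn by (auto simp: simple_connected_graph_def irreflp_def)
  moreover have "gdist adj y z \<le> 1" by (rule gdist_le) (use a in auto)
  ultimately show "gdist adj y z = Suc 0"
    by (metis One_nat_def gdist_eq_0 le_Suc_eq le_zero_eq)
qed

lemma gdist_intermediate:
  assumes "i \<le> gdist adj y z"
  obtains u where "gdist adj y u = i" "gdist adj u z = gdist adj y z - i"
proof -
  have "(adj ^^ (i + (gdist adj y z - i))) y z" using relpowp_gdist[of y z] assms by simp
  then obtain u where "(adj ^^ i) y u" "(adj ^^ (gdist adj y z - i)) u z"
    unfolding relpowp_add by auto
  then have "gdist adj y u \<le> i" "gdist adj u z \<le> gdist adj y z - i" by (auto intro: gdist_le)
  with gdist_triangle[of y z u] assms show ?thesis by (intro that[of u]) auto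
qed

lemma finite_gdists: "finite {gdist adj y z | y z. True}"
proof -
  have "{gdist adj y z | y z. True} = (\<lambda>(y, z). gdist adj y z) ` UNIV" by auto
  then show ?thesis by simp
qed

lemma gdist_le_diam: "gdist adj y z \<le> diam adj"
  unfolding diam_def by (rule Max_ge[OF finite_gdists]) auto

lemma diam_attained: "\<exists>y z. gdist adj y z = diam adj"
proof -
  have "diam adj \<in> {gdist adj y z | y z. True}"
    unfolding diam_def by (rule Max_in[OF finite_gdists]) auto
  then show ?thesis by (auto intro: sym)
qed

lemma card_sphere_eq:
  assumes "distance_regular adj"
  shows "card (sphere_at adj i y) = card (sphere_at adj i z)"
proof -
  have "card (sphere_at adj i y \<inter> sphere_at adj i y) = card (sphere_at adj i z \<inter> sphere_at adj i z)"
    using assms[unfolded distance_regular_def, rule_format, of y y 0 z z i i] by simp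
  then show ?thesis by simp
qed

lemma card_sphere_1:
  assumes "distance_regular adj"
  shows "card (sphere_at adj 1 y) = valency adj"
proof -
  have "(THE n. \<forall>y z. gdist adj y z = 0 \<longrightarrow> card (sphere_at adj 1 y \<inter> sphere_at adj 1 z) = n)
      = card (sphere_at adj 1 y)"
    using card_sphere_eq[OF assms, of 1] by (intro the_equality) auto
  then show ?thesis by (simp add: valency_def intersection_number_def)
qed

lemma sphere_diam_nonempty:
  assumes "distance_regular adj"
  shows "\<exists>y. gdist adj x y = diam adj"
proof -
  obtain u v where "gdist adj u v = diam adj" using diam_attained by blast
  then have "card (sphere_at adj (diam adj) u) > 0" by (auto simp: sphere_at_def card_gt_0_iff)
  then have "card (sphere_at adj (diam adj) x) > 0" using card_sphere_eq[OF assms] by metis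
  then show ?thesis by (auto simp: sphere_at_def card_gt_0_iff)
qed


section \<open>The Bose-Mesner algebra\<close>

text \<open>Every matrix in the Bose-Mesner algebra is a combination of the distance matrices.\<close>

lemma bose_mesner_distance_invariant:
  assumes dr: "distance_regular adj" and "M \<in> bose_mesner adj"
  shows "\<exists>f. \<forall>y z. M $ y $ z = f (gdist adj y z)"
  using assms(2) unfolding bose_mesner_def
proof (induction M)
  case one
  show ?case
    by (rule exI[of _ "\<lambda>n. if n = 0 then 1 else 0"]) (auto simp: Finite_Cartesian_Product.mat_def)
next
  case gen
  show ?case
    by (rule exI[of _ "\<lambda>n. if n = 1 then 1 else 0"]) (auto simp: distance_matrix_def)
next
  case (add M N)
  then obtain f g where "\<forall>y z. M $ y $ z = f (gdist adj y z)" "\<forall>y z. N $ y $ z = g (gdist adj y z)"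
    by blast
  then show ?case by (intro exI[of _ "\<lambda>n. f n + g n"]) simp
next
  case (smult M c)
  then obtain f where "\<forall>y z. M $ y $ z = f (gdist adj y z)" by blast
  then show ?case by (intro exI[of _ "\<lambda>n. c * f n"]) (simp add: smult_matrix_def)
next
  case (mult M N)
  then obtain f g where f: "\<And>y z. M $ y $ z = f (gdist adj y z)"
    and g: "\<And>y z. N $ y $ z = g (gdist adj y z)"
    by blast
  let ?D = "{..diam adj}"
  have prod: "(M ** N) $ y $ z
     = (\<Sum>i\<in>?D. \<Sum>j\<in>?D. f i * g j * of_nat (card (sphere_at adj i y \<inter> sphere_at adj j z)))" for y z
  proof -
    have "(M ** N) $ y $ z = (\<Sum>u\<in>UNIV. f (gdist adj y u) * g (gdist adj z u))"
      by (simp add: matrix_matrix_mult_def f g gdist_commute[of z])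
    also have "\<dots> = (\<Sum>u\<in>UNIV. \<Sum>i\<in>?D. \<Sum>j\<in>?D.
        if gdist adj y u = i then if gdist adj z u = j then f i * g j else 0 else 0)"
      by (simp add: gdist_le_diam if_distrib[of "\<lambda>t. sum t _"] sum.If_cases)
    also have "\<dots> = (\<Sum>i\<in>?D. \<Sum>j\<in>?D. \<Sum>u\<in>UNIV.
        if gdist adj y u = i then if gdist adj z u = j then f i * g j else 0 else 0)"
      by (subst sum.swap, rule sum.cong[OF refl], rule sum.swap)
    also have "\<dots> = (\<Sum>i\<in>?D. \<Sum>j\<in>?D. f i * g j * of_nat (card (sphere_at adj i y \<inter> sphere_at adj j z)))"
    proof (intro sum.cong[OF refl])
      fix i j
      have "(\<Sum>u\<in>UNIV. if gdist adj y u = i then if gdist adj z u = j then f i * g j else 0 else 0)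
         = (\<Sum>u\<in>UNIV. if u \<in> sphere_at adj i y \<inter> sphere_at adj j z then f i * g j else 0)"
        by (rule sum.cong) (auto simp: sphere_at_def)
      also have "\<dots> = f i * g j * of_nat (card (sphere_at adj i y \<inter> sphere_at adj j z))"
        by (simp add: sum.If_cases mult.commute Int_def)
      finally show "(\<Sum>u\<in>UNIV. if gdist adj y u = i then if gdist adj z u = j then f i * g j else 0 else 0)
         = f i * g j * of_nat (card (sphere_at adj i y \<inter> sphere_at adj j z))" .
    qed
    finally show ?thesis .
  qed
  have "(M ** N) $ y $ z = (M ** N) $ y' $ z'" if "gdist adj y z = gdist adj y' z'" for y z y' z'
  proof -
    have "card (sphere_at adj i y \<inter> sphere_at adj j z) = card (sphere_at adj i y' \<inter> sphere_at adj j z')"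
      for i j
      using dr[unfolded distance_regular_def, rule_format, of y z "gdist adj y z" y' z' i j] that by simp
    then show ?thesis unfolding prod by simp
  qed
  then show ?case
    by (intro exI[of _ "\<lambda>n. let p = SOME p. gdist adj (fst p) (snd p) = n in (M ** N) $ fst p $ snd p"])
      (metis (mono_tags, lifting) fst_conv snd_conv someI_ex)
qed

lemma bose_mesner_symmetric:
  assumes "distance_regular adj" "M \<in> bose_mesner adj"
  shows "M $ y $ z = M $ z $ y"
  using bose_mesner_distance_invariant[OF assms] gdist_commute by metis

lemma bose_mesner_commute:
  assumes dr: "distance_regular adj" and M: "M \<in> bose_mesner adj" and N: "N \<in> bose_mesner adj"
  shows "M ** N = N ** M"
proof -
  have MN: "M ** N \<in> bose_mesner adj"
    using M N unfolding bose_mesner_def by (rule generated_algebra.mult)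
  have "(M ** N) $ y $ z = (N ** M) $ y $ z" for y z
    unfolding bose_mesner_symmetric[OF dr MN, of y z]
    by (simp add: matrix_matrix_mult_def bose_mesner_symmetric[OF dr M, of y]
        bose_mesner_symmetric[OF dr N, of z] bose_mesner_symmetric[OF dr M, of z] bose_mesner_symmetric[OF dr N, of y] mult.commute)
  then show ?thesis by (simp add: Finite_Cartesian_Product.vec_eq_iff)
qed

end

lemma smult_matrix_nth [simp]: "smult_matrix c M $ y $ z = c * M $ y $ z"
  by (simp add: smult_matrix_def)

lemma smult_matrix_zero [simp]: "smult_matrix 0 M = 0" "smult_matrix c 0 = 0"
  by (simp_all add: Finite_Cartesian_Product.vec_eq_iff)

lemma smult_matrix_smult_matrix: "smult_matrix a (smult_matrix b M) = smult_matrix (a * b) M"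
  by (simp add: Finite_Cartesian_Product.vec_eq_iff)

lemma smult_matrix_mult_left: "smult_matrix c M ** N = smult_matrix c (M ** N)"
  by (simp add: Finite_Cartesian_Product.vec_eq_iff matrix_matrix_mult_def sum_distrib_left mult.assoc)

lemma smult_matrix_mult_right: "M ** smult_matrix c N = smult_matrix c (M ** N)"
  by (simp add: Finite_Cartesian_Product.vec_eq_iff matrix_matrix_mult_def sum_distrib_left mult.left_commute)

lemma matrix_add_rdistrib: "(M + K) ** N = M ** N + K ** (N :: complex^'v::finite^'v)"
  by (simp add: Finite_Cartesian_Product.vec_eq_iff matrix_matrix_mult_def sum.distrib algebra_simps)

lemma sum_matrix_mult_left: "(\<Sum>i\<in>I. f i) ** N = (\<Sum>i\<in>I. f i ** (N :: complex^'v::finite^'v))"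
  by (induction I rule: infinite_finite_induct) (auto simp: matrix_add_rdistrib)

lemma sum_matrix_mult_right: "N ** (\<Sum>i\<in>I. f i) = (\<Sum>i\<in>I. (N :: complex^'v::finite^'v) ** f i)"
  by (induction I rule: infinite_finite_induct) (auto simp: matrix_add_ldistrib)

lemma matrix_diff_rdistrib: "(M - K) ** N = M ** N - K ** (N :: complex^'v::finite^'v)"
  using matrix_add_rdistrib[of "M - K" K N] by (simp add: algebra_simps)

lemma matrix_diff_ldistrib: "N ** (M - K) = N ** M - (N :: complex^'v::finite^'v) ** K"
  using matrix_add_ldistrib[of N "M - K" K] by (simp add: algebra_simps)

lemma generated_algebra_diff:
  assumes "M \<in> generated_algebra B" "N \<in> generated_algebra B"
  shows "M - N \<in> generated_algebra B"
proof -
  have "M - N = M + smult_matrix (- 1) N" by (simp add: Finite_Cartesian_Product.vec_eq_iff)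
  then show ?thesis using assms by (simp only: generated_algebra.add generated_algebra.smult)
qed

lemma generated_algebra_sum:
  "(\<And>i. i \<in> I \<Longrightarrow> f i \<in> generated_algebra B) \<Longrightarrow> finite I \<Longrightarrow> sum f I \<in> generated_algebra B"
proof (induction I rule: infinite_finite_induct)
  case empty
  show ?case using generated_algebra.smult[OF generated_algebra.one, of 0 B] by simp
qed (auto intro: generated_algebra.add)


section \<open>The primitive idempotents\<close>

lemma primitive_idempotent_mult:
  assumes e: "primitive_idempotent (generated_algebra B) e"
    and f: "f \<in> generated_algebra B" "f ** f = f"
    and comm: "e ** f = f ** e"
  shows "e ** f = 0 \<or> e ** f = e"
proof -
  have e': "e \<in> generated_algebra B" "e ** e = e" using e by (auto simp: primitive_idempotent_def)
  let ?g = "e ** f"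
  have g: "?g \<in> generated_algebra B" "e - ?g \<in> generated_algebra B"
    using e' f by (auto intro: generated_algebra.mult generated_algebra_diff)
  have eg: "e ** ?g = ?g" by (simp add: matrix_mul_assoc e')
  have ge: "?g ** e = ?g" unfolding comm by (simp add: matrix_mul_assoc[symmetric] e')
  have gg: "?g ** ?g = ?g" by (metis matrix_mul_assoc f(2) ge)
  have "?g = 0 \<or> e - ?g = 0"
    using e g gg eg ge e'(2) unfolding primitive_idempotent_def
    by (auto simp: matrix_diff_ldistrib matrix_diff_rdistrib)
  then show ?thesis by auto
qed

context
  fixes adj :: "'v::finite \<Rightarrow> 'v \<Rightarrow> bool" and d :: nat and E :: "nat \<Rightarrow> complex^'v^'v" and \<theta> :: "nat \<Rightarrow> real"
  assumes conn: "simple_connected_graph adj" and dr: "distance_regular adj"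
    and diam: "diam adj = d" and d: "d \<ge> 1"
    and ord: "idempotent_ordering adj d E (\<lambda>i. of_real (\<theta> i))"
    and dec: "\<forall>i<d. \<theta> i > \<theta> (i + 1)"
begin

lemma eigenvalue_less: "i < j \<Longrightarrow> j \<le> d \<Longrightarrow> \<theta> j < \<theta> i"
proof (induction j)
  case (Suc j)
  then show ?case using dec[rule_format, of j] by (cases "i = j") auto
qed auto

lemma eigenvalue_inj: "i \<le> d \<Longrightarrow> j \<le> d \<Longrightarrow> \<theta> i = \<theta> j \<longleftrightarrow> i = j"
  using eigenvalue_less[of i j] eigenvalue_less[of j i] by (cases i j rule: linorder_cases) auto

lemma idempotent_primitive: "i \<le> d \<Longrightarrow> primitive_idempotent (bose_mesner adj) (E i)"
  using ord unfolding idempotent_ordering_def bij_betw_def by auto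

lemma idempotent_mem: "i \<le> d \<Longrightarrow> E i \<in> bose_mesner adj"
  using idempotent_primitive by (auto simp: primitive_idempotent_def)

lemma idempotent_mult:
  assumes "i \<le> d" "j \<le> d"
  shows "E i ** E j = (if i = j then E i else 0)"
proof -
  have E: "E k ** E k = E k" if "k \<le> d" for k
    using idempotent_primitive[OF that] by (auto simp: primitive_idempotent_def)
  have c: "E i ** E j = E j ** E i"
    using assms by (intro bose_mesner_commute[OF conn dr] idempotent_mem)
  have "E i ** E j = 0 \<or> E i ** E j = E i"
    by (rule primitive_idempotent_mult[of "adjacency_matrix adj"])
      (use assms idempotent_primitive idempotent_mem E c in \<open>auto simp: bose_mesner_def\<close>)
  moreover have "E j ** E i = 0 \<or> E j ** E i = E j"
    by (rule primitive_idempotent_mult[of "adjacency_matrix adj"])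
      (use assms idempotent_primitive idempotent_mem E c in \<open>auto simp: bose_mesner_def\<close>)
  moreover have "E i \<noteq> E j" if "i \<noteq> j"
    using ord assms that unfolding idempotent_ordering_def bij_betw_def inj_on_def by auto
  ultimately show ?thesis using c E assms by auto
qed

lemma adjacency_matrix_mult_idempotent:
  assumes "i \<le> d"
  shows "adjacency_matrix adj ** E i = smult_matrix (of_real (\<theta> i)) (E i)"
proof -
  have "adjacency_matrix adj = (\<Sum>j\<le>d. smult_matrix (of_real (\<theta> j)) (E j))"
    using ord by (simp add: idempotent_ordering_def)
  then have "adjacency_matrix adj ** E i = (\<Sum>j\<le>d. smult_matrix (of_real (\<theta> j)) (E j ** E i))"
    by (simp add: sum_matrix_mult_left smult_matrix_mult_left)
  also have "\<dots> = (\<Sum>j\<le>d. if j = i then smult_matrix (of_real (\<theta> i)) (E i) else 0)"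
    by (rule sum.cong) (auto simp: idempotent_mult assms Finite_Cartesian_Product.vec_eq_iff)
  finally show ?thesis using assms by simp
qed

text \<open>The difference \<open>e\<close> of the two sides is an idempotent annihilated by the adjacency matrix, so
  the whole algebra acts on it by scalars. If it were nonzero it would be primitive, hence one of the
  \<open>E j\<close>, although it is orthogonal to all of them.\<close>

lemma sum_idempotents: "(\<Sum>i\<le>d. E i) = Finite_Cartesian_Product.mat 1"
proof (rule ccontr)
  assume ne: "(\<Sum>i\<le>d. E i) \<noteq> Finite_Cartesian_Product.mat 1"
  define e where "e = Finite_Cartesian_Product.mat 1 - (\<Sum>i\<le>d. E i)"
  have e0: "e \<noteq> 0" using ne by (simp add: e_def)
  have mem: "e \<in> bose_mesner adj"
    unfolding e_def bose_mesner_def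
    by (intro generated_algebra_diff generated_algebra.one generated_algebra_sum)
      (use idempotent_mem[unfolded bose_mesner_def] in auto)
  have Ee: "E j ** e = 0" if "j \<le> d" for j
    using that by (simp add: e_def matrix_diff_ldistrib sum_matrix_mult_right idempotent_mult if_distrib cong: if_cong)
  have ee: "e ** e = e"
    by (subst (1) e_def) (simp add: matrix_diff_rdistrib sum_matrix_mult_left Ee)
  have "adjacency_matrix adj = (\<Sum>j\<le>d. smult_matrix (of_real (\<theta> j)) (E j))"
    using ord by (simp add: idempotent_ordering_def)
  then have Ae: "adjacency_matrix adj ** e = smult_matrix 0 e"
    by (simp add: sum_matrix_mult_left smult_matrix_mult_left Ee)
  have scal: "\<exists>c. M ** e = smult_matrix c e" if "M \<in> bose_mesner adj" for M
    using that unfolding bose_mesner_def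
  proof (induction M)
    case one
    show ?case by (rule exI[of _ 1]) (simp add: Finite_Cartesian_Product.vec_eq_iff)
  next
    case gen
    show ?case using Ae by blast
  next
    case (add M N)
    then obtain a b where "M ** e = smult_matrix a e" "N ** e = smult_matrix b e" by blast
    then show ?case
      by (intro exI[of _ "a + b"]) (simp add: matrix_add_rdistrib Finite_Cartesian_Product.vec_eq_iff algebra_simps)
  next
    case (smult M c)
    then obtain a where "M ** e = smult_matrix a e" by blast
    then show ?case
      by (intro exI[of _ "c * a"]) (simp add: smult_matrix_mult_left Finite_Cartesian_Product.vec_eq_iff algebra_simps)
  next
    case (mult M N)
    then obtain a b where "M ** e = smult_matrix a e" "N ** e = smult_matrix b e" by blast
    then show ?case
      by (intro exI[of _ "b * a"])
        (simp add: matrix_mul_assoc[symmetric] smult_matrix_mult_right smult_matrix_smult_matrix)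
  qed
  obtain u v where uv: "e $ u $ v \<noteq> 0" using e0 by (auto simp: Finite_Cartesian_Product.vec_eq_iff)
  have "primitive_idempotent (bose_mesner adj) e"
    unfolding primitive_idempotent_def
  proof (intro conjI ballI impI)
    fix f g assume "f \<in> bose_mesner adj"
      and fg: "f ** f = f \<and> g ** g = g \<and> f ** g = 0 \<and> g ** f = 0 \<and> e = f + g"
    then obtain c where c: "f ** e = smult_matrix c e" using scal by blast
    have "f ** e = f" using fg by (simp add: matrix_add_ldistrib)
    then have f: "f = smult_matrix c e" using c by simp
    have "smult_matrix c e ** smult_matrix c e = smult_matrix c e" using fg f by metis
    then have "smult_matrix (c * c) e = smult_matrix c e"
      by (simp add: smult_matrix_mult_left smult_matrix_mult_right smult_matrix_smult_matrix ee)
    then have "c * c * e $ u $ v = c * e $ u $ v"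
      by (metis smult_matrix_nth)
    then have "c = 0 \<or> c = 1" using uv by auto
    then show "f = 0 \<or> g = 0"
    proof
      assume "c = 0"
      then show ?thesis using f smult_matrix_zero(1) by metis
    next
      assume "c = 1"
      moreover have "smult_matrix 1 e = e" by (simp add: Finite_Cartesian_Product.vec_eq_iff)
      ultimately have "f = e" using f by metis
      then show ?thesis using fg by (metis add_cancel_right_right)
    qed
  qed (use mem e0 ee in auto)
  then have "e \<in> E ` {0..d}"
    using ord unfolding idempotent_ordering_def bij_betw_def by blast
  then obtain j where "j \<le> d" "e = E j" by auto
  then show False using Ee[of j] ee e0 by metis
qed

text \<open>Write \<open>F\<close> for the conjugate transpose of \<open>E j\<close>. Since the adjacency matrix is real symmetric
  and the eigenvalues are real and distinct, \<open>F E i = 0\<close> for \<open>i \<noteq> j\<close>. The idempotents sum to the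
  identity, so \<open>F = F E j\<close>, which is the claim because \<open>E j\<close> is symmetric. Thus the conjugate of
  \<open>E j\<close> is a Gram matrix, in particular positive semidefinite.\<close>

lemma idempotent_positive:
  assumes j: "j \<le> d"
  shows "cnj (E j $ y $ z) = (\<Sum>u\<in>UNIV. cnj (E j $ u $ y) * E j $ u $ z)"
proof -
  define F where "F = (\<chi> y z. cnj (E j $ z $ y))"
  let ?A = "adjacency_matrix adj"
  have "F ** ?A = smult_matrix (of_real (\<theta> j)) F"
  proof -
    have "(F ** ?A) $ y $ z = smult_matrix (of_real (\<theta> j)) F $ y $ z" for y z
    proof -
      have A: "?A $ u $ z = cnj (?A $ z $ u)" for u
        by (simp add: distance_matrix_def gdist_commute[OF conn, of u])
      have "(F ** ?A) $ y $ z = cnj ((?A ** E j) $ z $ y)"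
        by (simp add: F_def matrix_matrix_mult_def A mult.commute del: One_nat_def)
      then show ?thesis unfolding adjacency_matrix_mult_idempotent[OF j] by (simp add: F_def)
    qed
    then show ?thesis by (simp add: Finite_Cartesian_Product.vec_eq_iff)
  qed
  then have FE: "smult_matrix (of_real (\<theta> j)) (F ** E i) = smult_matrix (of_real (\<theta> i)) (F ** E i)"
    if "i \<le> d" for i
    by (metis adjacency_matrix_mult_idempotent[OF that] matrix_mul_assoc smult_matrix_mult_left smult_matrix_mult_right)
  have FE0: "F ** E i = 0" if "i \<le> d" "i \<noteq> j" for i
  proof -
    have "of_real (\<theta> j) * (F ** E i) $ y $ z = of_real (\<theta> i) * (F ** E i) $ y $ z" for y z
      using FE[OF that(1)] by (metis smult_matrix_nth)
    moreover have "\<theta> j \<noteq> \<theta> i" using eigenvalue_inj[OF j that(1)] that(2) by auto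
    ultimately show ?thesis by (auto simp: Finite_Cartesian_Product.vec_eq_iff)
  qed
  have "F = F ** (\<Sum>i\<le>d. E i)" by (simp add: sum_idempotents)
  also have "\<dots> = (\<Sum>i\<le>d. if i = j then F ** E j else 0)"
    unfolding sum_matrix_mult_right by (rule sum.cong) (auto simp: FE0)
  also have "\<dots> = F ** E j" using j by simp
  finally have "F $ y $ z = (F ** E j) $ y $ z" by simp
  moreover have "F $ y $ z = cnj (E j $ y $ z)"
    unfolding F_def using bose_mesner_symmetric[OF conn dr idempotent_mem[OF j], of z y] by simp
  ultimately show ?thesis by (simp add: F_def matrix_matrix_mult_def)
qed

lemma idempotent_diagonal_nonneg: "j \<le> d \<Longrightarrow> Re (E j $ y $ y) \<ge> 0"
proof -
  assume j: "j \<le> d"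
  have "Re (E j $ y $ y) = Re (cnj (E j $ y $ y))" by simp
  also have "\<dots> = (\<Sum>u\<in>UNIV. Re (cnj (E j $ u $ y) * E j $ u $ y))"
    by (subst idempotent_positive[OF j]) simp
  also have "\<dots> \<ge> 0" by (intro sum_nonneg) simp
  finally show ?thesis .
qed

text \<open>Otherwise all eigenvalues are nonnegative and \<open>\<theta> 0\<close> is positive. As the idempotents have
  nonnegative diagonal, each diagonal entry of the adjacency matrix would be at least
  \<open>\<theta> 0 / |X| > 0\<close>, but it is zero.\<close>

lemma least_eigenvalue_negative: "\<theta> d < 0"
proof (rule ccontr)
  assume "\<not> \<theta> d < 0"
  then have nn: "\<theta> i \<ge> 0" if "i \<le> d" for i
    using eigenvalue_less[of i d] that by (cases "i = d") auto
  have pos: "\<theta> 0 > 0" using eigenvalue_less[of 0 d] d \<open>\<not> \<theta> d < 0\<close> by auto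
  fix y :: 'v
  have "0 = Re (adjacency_matrix adj $ y $ y)"
    using gdist_eq_0[OF conn, of y y] by (simp add: distance_matrix_def)
  also have "adjacency_matrix adj = (\<Sum>j\<le>d. smult_matrix (of_real (\<theta> j)) (E j))"
    using ord by (simp add: idempotent_ordering_def)
  also have "Re ((\<Sum>j\<le>d. smult_matrix (of_real (\<theta> j)) (E j)) $ y $ y) = (\<Sum>j\<le>d. \<theta> j * Re (E j $ y $ y))"
    by (simp add: sum_component)
  also have "\<dots> \<ge> (\<Sum>j\<in>{0}. \<theta> j * Re (E j $ y $ y))"
    by (rule sum_mono2) (auto intro!: mult_nonneg_nonneg nn idempotent_diagonal_nonneg)
  finally have "\<theta> 0 * Re (E 0 $ y $ y) \<le> 0" by simp
  moreover have "E 0 $ y $ y = 1 / of_nat CARD('v)" using ord by (simp add: idempotent_ordering_def)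
  ultimately have "\<theta> 0 / real CARD('v) \<le> 0" by simp
  moreover have "\<theta> 0 / real CARD('v) > 0" using pos by simp
  ultimately show False by linarith
qed


section \<open>Delsarte cliques have covering radius at most \<open>d - 1\<close>\<close>

text \<open>The polynomial \<open>\<Prod>i=1..n. (A - \<theta> i)\<close> in the adjacency matrix \<open>A\<close>; the factor for
  \<open>\<theta> 0\<close> is left out.\<close>

primrec adjacency_poly :: "nat \<Rightarrow> complex^'v^'v" where
  "adjacency_poly 0 = Finite_Cartesian_Product.mat 1"
| "adjacency_poly (Suc n) = adjacency_matrix adj ** adjacency_poly n
     - smult_matrix (of_real (\<theta> (Suc n))) (adjacency_poly n)"

lemma adjacency_poly_support: "n < gdist adj y z \<Longrightarrow> adjacency_poly n $ y $ z = 0"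
proof (induction n arbitrary: y)
  case 0
  then have "y \<noteq> z" using gdist_eq_0[OF conn, of y z] by auto
  then show ?case by (simp add: Finite_Cartesian_Product.mat_def)
next
  case (Suc n)
  have "adjacency_matrix adj $ y $ u * adjacency_poly n $ u $ z = 0" for u
  proof (cases "gdist adj y u = 1")
    case True
    then have "n < gdist adj u z" using Suc.prems gdist_triangle[OF conn, of y z u] by simp
    then show ?thesis by (simp add: Suc.IH)
  qed (simp add: distance_matrix_def)
  then have "(\<Sum>u\<in>UNIV. adjacency_matrix adj $ y $ u * adjacency_poly n $ u $ z) = 0"
    by (intro sum.neutral) blast
  then have "(adjacency_matrix adj ** adjacency_poly n) $ y $ z = 0"
    by (simp add: matrix_matrix_mult_def)
  moreover have "adjacency_poly n $ y $ z = 0" using Suc by auto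
  ultimately show ?case by simp
qed

lemma adjacency_poly_mult_idempotent:
  "j \<le> d \<Longrightarrow> adjacency_poly n ** E j = smult_matrix (\<Prod>i=1..n. of_real (\<theta> j - \<theta> i)) (E j)"
proof (induction n)
  case 0
  then show ?case by (simp add: Finite_Cartesian_Product.vec_eq_iff)
next
  case (Suc n)
  let ?p = "\<Prod>i=1..n. complex_of_real (\<theta> j - \<theta> i)"
  have "adjacency_poly (Suc n) ** E j
      = adjacency_matrix adj ** smult_matrix ?p (E j) - smult_matrix (of_real (\<theta> (Suc n))) (smult_matrix ?p (E j))"
    using Suc by (simp add: matrix_diff_rdistrib smult_matrix_mult_left matrix_mul_assoc[symmetric])
  also have "\<dots> = smult_matrix ?p (smult_matrix (of_real (\<theta> j)) (E j))
      - smult_matrix (of_real (\<theta> (Suc n))) (smult_matrix ?p (E j))"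
    unfolding smult_matrix_mult_right adjacency_matrix_mult_idempotent[OF Suc.prems] ..
  also have "\<dots> = smult_matrix (\<Prod>i=1..Suc n. of_real (\<theta> j - \<theta> i)) (E j)"
    by (simp add: Finite_Cartesian_Product.vec_eq_iff algebra_simps)
  finally show ?case .
qed

context
  fixes C :: "'v set"
  assumes cl: "delsarte_clique adj (\<theta> d) C"
begin

text \<open>The quadratic form of \<open>E d\<close> on the characteristic vector of \<open>C\<close> vanishes: with \<open>e0\<close> and
  \<open>e1\<close> the entries of \<open>E d\<close> at distances \<open>0\<close> and \<open>1\<close> it equals
  \<open>|C| (e0 + (|C| - 1) e1)\<close>, where \<open>k e1 = \<theta> d e0\<close>.\<close>

lemma clique_quadratic_form: "(\<Sum>y\<in>C. \<Sum>z\<in>C. E d $ y $ z) = 0"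
proof -
  obtain f where f: "\<And>y z. E d $ y $ z = f (gdist adj y z)"
    using bose_mesner_distance_invariant[OF conn dr idempotent_mem[of d]] by auto
  let ?k = "valency adj"
  have ke: "of_nat ?k * f 1 = of_real (\<theta> d) * f 0"
  proof -
    fix y :: 'v
    have "(adjacency_matrix adj ** E d) $ y $ y
        = (\<Sum>u\<in>UNIV. if u \<in> sphere_at adj 1 y then f 1 else 0)"
      unfolding matrix_matrix_mult_def
      by (simp add: distance_matrix_def sphere_at_def f gdist_commute[OF conn, of _ y] del: One_nat_def)
         (rule sum.cong, auto)
    also have "\<dots> = of_nat ?k * f 1"
      using card_sphere_1[OF conn dr, of y] by (simp add: sum.If_cases)
    finally show ?thesis
      unfolding adjacency_matrix_mult_idempotent[OF order_refl]
      using gdist_eq_0[OF conn, of y y] by (simp add: f)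
  qed
  have C: "finite C" "C \<noteq> {}" using cl by (auto simp: delsarte_clique_def)
  have row: "(\<Sum>z\<in>C. E d $ y $ z) = f 0 + (of_nat (card C) - 1) * f 1" if "y \<in> C" for y
  proof -
    have "(\<Sum>z\<in>C. E d $ y $ z) = E d $ y $ y + (\<Sum>z\<in>C - {y}. E d $ y $ z)"
      using C that by (simp add: sum.remove)
    also have "(\<Sum>z\<in>C - {y}. E d $ y $ z) = (\<Sum>z\<in>C - {y}. f 1)"
    proof (rule sum.cong)
      fix z assume "z \<in> C - {y}"
      then have "adj y z" using cl that by (auto simp: delsarte_clique_def)
      then show "E d $ y $ z = f 1" using gdist_eq_1[OF conn, of y z] f by simp
    qed simp
    also have "E d $ y $ y = f 0" using f gdist_eq_0[OF conn, of y y] by simp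
    moreover have "of_nat (card C - 1) = (of_nat (card C) - 1 :: complex)"
      using C by (simp add: of_nat_diff Suc_leI card_gt_0_iff)
    ultimately show ?thesis using that C by simp
  qed
  have "(of_nat (card C) - 1 :: complex) = - of_nat ?k / of_real (\<theta> d)"
  proof -
    have "real (card C) - 1 = - real ?k / \<theta> d" using cl by (simp add: delsarte_clique_def)
    then have "complex_of_real (real (card C) - 1) = complex_of_real (- real ?k / \<theta> d)" by (rule arg_cong)
    then show ?thesis by simp
  qed
  then have "f 0 + (of_nat (card C) - 1) * f 1 = f 0 - of_nat ?k * f 1 / of_real (\<theta> d)" by simp
  also have "\<dots> = 0" unfolding ke using least_eigenvalue_negative by simp
  finally show ?thesis by (simp add: row)
qed

text \<open>The quadratic form is the squared norm of \<open>E d\<close> applied to the characteristic vector.\<close>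

lemma clique_row_sum_least: "(\<Sum>z\<in>C. E d $ u $ z) = 0"
proof -
  let ?s = "\<lambda>u. \<Sum>z\<in>C. E d $ u $ z"
  have "0 = cnj (\<Sum>y\<in>C. \<Sum>z\<in>C. E d $ y $ z)" by (simp add: clique_quadratic_form)
  also have "\<dots> = (\<Sum>y\<in>C. \<Sum>z\<in>C. \<Sum>u\<in>UNIV. cnj (E d $ u $ y) * E d $ u $ z)"
    unfolding cnj_sum by (intro sum.cong refl idempotent_positive[OF order_refl])
  also have "\<dots> = (\<Sum>u\<in>UNIV. cnj (?s u) * ?s u)"
    unfolding cnj_sum sum_product
    by (subst sum.swap, subst (2) sum.swap, subst sum.swap, rule sum.cong[OF refl], subst sum.swap) (rule refl)
  finally have "complex_of_real (\<Sum>u\<in>UNIV. (cmod (?s u))\<^sup>2) = 0"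
    by (simp add: complex_norm_square mult.commute del: of_real_power)
  then have "(\<Sum>u\<in>UNIV. (cmod (?s u))\<^sup>2) = 0" by (simp only: of_real_eq_0_iff)
  then have "\<forall>u\<in>UNIV. (cmod (?s u))\<^sup>2 = 0" by (subst (asm) sum_nonneg_eq_0_iff) auto
  then show ?thesis by simp
qed

text \<open>Multiplied by \<open>\<Prod>i=1..d-1. (A - \<theta> i)\<close>, the characteristic vector of \<open>C\<close> has only its
  component in the constant vectors left, and that component is not zero. Every vertex is therefore
  at distance at most \<open>d - 1\<close> from \<open>C\<close>.\<close>

lemma delsarte_covering_radius: "\<exists>z\<in>C. gdist adj y z < d"
proof (rule ccontr)
  assume "\<not> (\<exists>z\<in>C. gdist adj y z < d)"
  then have "adjacency_poly (d - 1) $ y $ z = 0" if "z \<in> C" for z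
    using that d by (intro adjacency_poly_support) auto
  then have "0 = (\<Sum>z\<in>C. adjacency_poly (d - 1) $ y $ z)" by simp
  also have "adjacency_poly (d - 1) = (\<Sum>j\<le>d. adjacency_poly (d - 1) ** E j)"
    unfolding sum_matrix_mult_right[symmetric] sum_idempotents by simp
  also have "\<dots> = (\<Sum>j\<le>d. smult_matrix (\<Prod>i=1..d-1. of_real (\<theta> j - \<theta> i)) (E j))"
    by (intro sum.cong refl adjacency_poly_mult_idempotent) simp
  also have "(\<Sum>z\<in>C. \<dots> $ y $ z)
      = (\<Sum>j\<le>d. (\<Prod>i=1..d-1. of_real (\<theta> j - \<theta> i)) * (\<Sum>z\<in>C. E j $ y $ z))"
    unfolding sum_component smult_matrix_nth sum_distrib_left by (rule sum.swap)
  also have "\<dots> = (\<Sum>j\<in>{0}. (\<Prod>i=1..d-1. of_real (\<theta> j - \<theta> i)) * (\<Sum>z\<in>C. E j $ y $ z))"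
  proof (rule sum.mono_neutral_right)
    show "\<forall>j\<in>{..d} - {0}. (\<Prod>i=1..d-1. of_real (\<theta> j - \<theta> i)) * (\<Sum>z\<in>C. E j $ y $ z) = (0 :: complex)"
    proof
      fix j assume j: "j \<in> {..d} - {0}"
      show "(\<Prod>i=1..d-1. of_real (\<theta> j - \<theta> i)) * (\<Sum>z\<in>C. E j $ y $ z) = (0 :: complex)"
      proof (cases "j = d")
        case True
        then show ?thesis by (simp add: clique_row_sum_least)
      next
        case False
        then have "j \<in> {1..d-1}" using j by auto
        then have "(\<Prod>i=1..d-1. complex_of_real (\<theta> j - \<theta> i)) = 0" by (intro prod_zero) auto
        then show ?thesis by simp
      qed
    qed
  qed auto
  also have "\<dots> = (\<Prod>i=1..d-1. of_real (\<theta> 0 - \<theta> i)) * (of_nat (card C) / of_nat CARD('v))"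
    using ord by (simp add: idempotent_ordering_def)
  finally have "(\<Prod>i=1..d-1. complex_of_real (\<theta> 0 - \<theta> i)) * (of_nat (card C) / of_nat CARD('v)) = 0"
    by simp
  moreover have "(\<Prod>i=1..d-1. complex_of_real (\<theta> 0 - \<theta> i)) \<noteq> 0"
  proof -
    have "complex_of_real (\<theta> 0 - \<theta> i) \<noteq> 0" if "i \<in> {1..d-1}" for i
    proof -
      have "\<theta> i < \<theta> 0" using that d by (intro eigenvalue_less) auto
      then show ?thesis by simp
    qed
    then show ?thesis by (simp only: prod_zero_iff finite_atLeastAtMost) blast
  qed
  moreover have "card C \<noteq> 0" using cl by (auto simp: delsarte_clique_def)
  ultimately show False by simp
qed


section \<open>The cells of the clique partition are nonempty\<close>

lemma set_gdist_attained: "\<exists>z\<in>C. set_gdist adj y C = gdist adj y z"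
proof -
  have "set_gdist adj y C \<in> gdist adj y ` C"
    unfolding set_gdist_def using cl by (intro Min_in) (auto simp: delsarte_clique_def)
  then show ?thesis by auto
qed

lemma set_gdist_le: "z \<in> C \<Longrightarrow> set_gdist adj y C \<le> gdist adj y z"
  unfolding set_gdist_def by (intro Min_le) auto

lemma gdist_le_Suc_set_gdist:
  assumes "x \<in> C"
  shows "gdist adj y x \<le> set_gdist adj y C + 1"
proof -
  obtain z where z: "z \<in> C" "set_gdist adj y C = gdist adj y z" using set_gdist_attained by blast
  have "gdist adj z x \<le> 1"
    using cl z assms gdist_eq_1[OF conn, of z x] gdist_eq_0[OF conn, of z x]
    by (cases "z = x") (auto simp: delsarte_clique_def)
  then show ?thesis using gdist_triangle[OF conn, of y x z] z by simp
qed

lemma clique_cell_split: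
  assumes "x \<in> C"
  shows "clique_cell adj C i = C_minus adj C x i \<union> C_plus adj C x i"
    and "C_minus adj C x i \<inter> C_plus adj C x i = {}"
proof -
  have "gdist adj x y = i \<or> gdist adj x y = i + 1" if "set_gdist adj y C = i" for y
    using set_gdist_le[OF assms, of y] gdist_le_Suc_set_gdist[OF assms, of y] that
      gdist_commute[OF conn, of x y] by auto
  then show "clique_cell adj C i = C_minus adj C x i \<union> C_plus adj C x i"
    by (auto simp: clique_cell_def C_minus_def C_plus_def sphere_at_def)
  show "C_minus adj C x i \<inter> C_plus adj C x i = {}"
    by (auto simp: C_minus_def C_plus_def sphere_at_def)
qed

lemma sphere_split:
  assumes "x \<in> C"
  shows "sphere_at adj (Suc i) x = C_minus adj C x (Suc i) \<union> C_plus adj C x i"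
    and "C_minus adj C x (Suc i) \<inter> C_plus adj C x i = {}"
proof -
  have "set_gdist adj y C = Suc i \<or> set_gdist adj y C = i" if "gdist adj x y = Suc i" for y
    using set_gdist_le[OF assms, of y] gdist_le_Suc_set_gdist[OF assms, of y] that
      gdist_commute[OF conn, of x y] by auto
  then show "sphere_at adj (Suc i) x = C_minus adj C x (Suc i) \<union> C_plus adj C x i"
    by (auto simp: clique_cell_def C_minus_def C_plus_def sphere_at_def)
  show "C_minus adj C x (Suc i) \<inter> C_plus adj C x i = {}"
    by (auto simp: C_minus_def C_plus_def clique_cell_def)
qed

text \<open>By the two partitions above, \<open>|C\<^sub>i\<^sup>-|\<close> is determined by the numbers \<open>|\<Gamma>\<^sub>j(x)|\<close> and
  \<open>|C\<^sub>j|\<close> alone.\<close>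

lemma card_C_minus_independent:
  assumes "x \<in> C" "x' \<in> C"
  shows "card (C_minus adj C x i) = card (C_minus adj C x' i)"
proof (induction i)
  case 0
  have "C_minus adj C y 0 = {y}" if "y \<in> C" for y
  proof -
    have "set_gdist adj y C = 0"
      using set_gdist_le[OF that, of y] gdist_eq_0[OF conn, of y y] by (metis le_zero_eq)
    then show ?thesis
      by (auto simp: C_minus_def clique_cell_def sphere_at_def gdist_eq_0[OF conn])
  qed
  then show ?case using assms by simp
next
  case (Suc i)
  have "card (C_minus adj C y i) + card (C_plus adj C y i) = card (clique_cell adj C i)"
    "card (C_minus adj C y (Suc i)) + card (C_plus adj C y i) = card (sphere_at adj (Suc i) y)"
    if "y \<in> C" for y
    unfolding clique_cell_split(1)[OF that, of i] sphere_split(1)[OF that, of i]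
    by (simp_all add: card_Un_disjoint clique_cell_split(2)[OF that] sphere_split(2)[OF that])
  note sizes = this
  show ?case
    using Suc card_sphere_eq[OF conn dr, of "Suc i" x x'] sizes[OF assms(1)] sizes[OF assms(2)]
    by linarith
qed

text \<open>A geodesic from the clique to a vertex at distance \<open>d\<close> from \<open>x\<close> passes through all of
  these cells.\<close>

lemma C_plus_nonempty:
  assumes "x \<in> C" "i < d"
  shows "C_plus adj C x i \<noteq> {}"
proof -
  obtain y where y: "gdist adj x y = d" using sphere_diam_nonempty[OF conn dr] diam by auto
  obtain z where z: "z \<in> C" "gdist adj y z < d" using delsarte_covering_radius by blast
  have "gdist adj y x \<le> set_gdist adj y C + 1" by (rule gdist_le_Suc_set_gdist[OF assms(1)])
  then have "gdist adj z y = d - 1"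
    using y z set_gdist_le[OF z(1), of y] gdist_commute[OF conn, of x y] gdist_commute[OF conn, of z y] by simp
  moreover have "i \<le> d - 1" using assms(2) by simp
  ultimately obtain u where u: "gdist adj z u = i" "gdist adj u y = d - 1 - i"
    using gdist_intermediate[OF conn, of i z y] by metis
  have "gdist adj x u \<ge> i + 1" using gdist_triangle[OF conn, of x y u] y u assms(2) by simp
  then have "gdist adj x u = i + 1 \<and> set_gdist adj u C = i"
    using set_gdist_le[OF z(1), of u] gdist_le_Suc_set_gdist[OF assms(1), of u] u
      gdist_commute[OF conn, of x u] gdist_commute[OF conn, of z u] by simp
  then show ?thesis by (auto simp: C_plus_def clique_cell_def sphere_at_def)
qed

text \<open>A vertex at distance \<open>d\<close> from \<open>x\<close> is at distance \<open>d - 1\<close> from some \<open>z \<in> C\<close> and from \<open>C\<close>,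
  so the last cell is nonempty for the base point \<open>z\<close>, hence for every base point.\<close>

lemma C_minus_nonempty:
  assumes "x \<in> C" "i < d"
  shows "C_minus adj C x i \<noteq> {}"
proof -
  obtain y where y: "gdist adj x y = d" using sphere_diam_nonempty[OF conn dr] diam by auto
  obtain z where z: "z \<in> C" "gdist adj y z < d" using delsarte_covering_radius by blast
  have "gdist adj y x \<le> set_gdist adj y C + 1" by (rule gdist_le_Suc_set_gdist[OF assms(1)])
  then have "gdist adj z y = d - 1 \<and> set_gdist adj y C = d - 1"
    using y z set_gdist_le[OF z(1), of y] gdist_commute[OF conn, of x y] gdist_commute[OF conn, of z y] by linarith
  then have "y \<in> C_minus adj C z (d - 1)" by (auto simp: C_minus_def clique_cell_def sphere_at_def)
  then have "card (C_minus adj C z (d - 1)) > 0" by (auto simp: card_gt_0_iff)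
  then have "card (C_minus adj C x (d - 1)) > 0"
    using card_C_minus_independent[OF assms(1) z(1)] by simp
  then obtain v where v: "gdist adj x v = d - 1" "set_gdist adj v C = d - 1"
    by (auto simp: card_gt_0_iff C_minus_def clique_cell_def sphere_at_def)
  moreover have "i \<le> d - 1" using assms(2) by simp
  ultimately obtain u where u: "gdist adj x u = i" "gdist adj u v = d - 1 - i"
    using gdist_intermediate[OF conn, of i x v] by metis
  obtain c where c: "c \<in> C" "set_gdist adj u C = gdist adj u c" using set_gdist_attained by blast
  have "d - 1 \<le> gdist adj v c" using set_gdist_le[OF c(1), of v] v by simp
  also have "\<dots> \<le> gdist adj v u + gdist adj u c" by (rule gdist_triangle[OF conn])
  finally have "i \<le> set_gdist adj u C" using u c gdist_commute[OF conn, of u v] assms(2) by simp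
  then have "set_gdist adj u C = i"
    using set_gdist_le[OF assms(1), of u] u gdist_commute[OF conn, of x u] by simp
  then show ?thesis using u by (auto simp: C_minus_def clique_cell_def sphere_at_def)
qed

end

end


section \<open>The module\<close>

lemma linear_matrix_operator:
  assumes "ordered_basis ws W"
  shows "\<exists>f. Vector_Spaces.linear (*s) (*s) f \<and>
    (\<forall>j<length ws. f (ws ! j) = (\<Sum>a<length ws. N $$ (a, j) *s (ws ! a)))"
proof -
  define g where "g = (\<lambda>v. \<Sum>a<length ws. N $$ (a, SOME j. j < length ws \<and> ws ! j = v) *s (ws ! a))"
  have "g (ws ! j) = (\<Sum>a<length ws. N $$ (a, j) *s (ws ! a))" if "j < length ws" for j
  proof -
    have "(SOME i. i < length ws \<and> ws ! i = ws ! j) = j"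
      using that assms by (intro some_equality) (auto simp: ordered_basis_def nth_eq_iff_index_eq)
    then show ?thesis by (simp add: g_def)
  qed
  moreover obtain f where "Vector_Spaces.linear (*s) (*s) f" "\<forall>v\<in>set ws. f v = g v"
    using vec.linear_independent_extend[of "set ws" g] assms by (auto simp: ordered_basis_def)
  ultimately show ?thesis by auto
qed

text \<open>Everything except the nonemptiness of the cells: the matrices define a module on any space
  with a basis of size \<open>2 d\<close>.\<close>

lemma T_matrix_module:
  fixes ws :: "(complex^'v::finite) list"
  assumes basis: "ordered_basis ws W" and len: "length ws = 2 * d" and d: "0 < d"
    and nz: "qh \<noteq> 0" "ssh \<noteq> 0" "r1h \<noteq> 0" "r2h \<noteq> 0"
    and ss: "\<And>k. 2 \<le> k \<Longrightarrow> k \<le> 2 * d \<Longrightarrow> ssh\<^sup>2 * (qh\<^sup>2) ^ k \<noteq> 1"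
  shows "\<exists>act. module_structure (H_hat qh) (\<lambda>c. H_class qh (fscalar c)) W act \<and>
           (\<forall>n. represents (T_matrix d qh ssh r1h r2h n) (act (H_gen qh n)) ws W)"
proof -
  have "\<forall>n. \<exists>f. Vector_Spaces.linear (*s) (*s) f \<and>
      (\<forall>j<length ws. f (ws ! j) = (\<Sum>a<length ws. T_matrix d qh ssh r1h r2h n $$ (a, j) *s (ws ! a)))"
    using linear_matrix_operator[OF basis] by blast
  then obtain t where lin: "\<And>n. Vector_Spaces.linear (*s) (*s) (t n)"
    and t: "\<And>n j. j < 2 * d \<Longrightarrow> t n (ws ! j) = (\<Sum>a<2 * d. T_matrix d qh ssh r1h r2h n $$ (a, j) *s (ws ! a))"
    unfolding len by metis
  let ?c = "central_value d qh ssh r1h r2h"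
  note la = vec.linear_add[OF lin] vec.linear_scale[OF lin] vec.linear_0[OF lin]
  have W: "W = vec.span (set ws)" and sub: "vec.subspace W"
    using basis by (auto simp: ordered_basis_def)
  have wsW: "ws ! j \<in> W" if "j < 2 * d" for j
    using that len unfolding W by (intro vec.span_base) simp
  have onW: "P v" if "v \<in> W" and "P 0" and "\<And>c j u. j < 2 * d \<Longrightarrow> P u \<Longrightarrow> P (c *s (ws ! j) + u)"
    for P v
    using that(1) unfolding W
  proof (induction rule: vec.span_induct_alt)
    case (step c u v)
    then show ?case using that(3) len by (metis in_set_conv_nth)
  qed (rule that(2))
  have inv: "t n v \<in> W" if "v \<in> W" for n v
  proof (rule onW[OF that])
    fix c j u assume "j < 2 * d" "t n u \<in> W"
    then show "t n (c *s (ws ! j) + u) \<in> W"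
      unfolding la using t[of j n] wsW
      by (auto intro!: vec.subspace_add[OF sub] vec.subspace_scale[OF sub] vec.subspace_sum[OF sub])
  qed (simp add: la vec.subspace_0[OF sub])
  have quad_basis: "t n (t n (ws ! j)) = ?c n *s t n (ws ! j) - ws ! j" if "j < 2 * d" for n j
    by (rule operator_quadratic[where w = "\<lambda>j. ws ! j", OF lin _ d nz _ that]) (fact t, fact ss)
  have prod_basis: "t 0 (t 1 (t 2 (t 3 (ws ! j)))) = inverse qh *s ws ! j" if "j < 2 * d" for j
    by (rule operator_product[where w = "\<lambda>j. ws ! j", OF lin _ d nz _ that]) (fact t, fact ss)
  have quad: "t n (t n v) = ?c n *s t n v - v" if "v \<in> W" for n v
  proof (rule onW[OF that])
    fix c j u assume *: "j < 2 * d" "t n (t n u) = ?c n *s t n u - u"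
    then show "t n (t n (c *s (ws ! j) + u)) = ?c n *s t n (c *s (ws ! j) + u) - (c *s (ws ! j) + u)"
      unfolding la quad_basis[OF *(1)] *(2) by (simp add: Finite_Cartesian_Product.vec_eq_iff algebra_simps)
  qed (simp add: la)
  have prod: "t 0 (t 1 (t 2 (t 3 v))) = inverse qh *s v" if "v \<in> W" for v
  proof (rule onW[OF that])
    fix c j u assume *: "j < 2 * d" "t 0 (t 1 (t 2 (t 3 u))) = inverse qh *s u"
    then show "t 0 (t 1 (t 2 (t 3 (c *s (ws ! j) + u)))) = inverse qh *s (c *s (ws ! j) + u)"
      unfolding la prod_basis[OF *(1)] *(2) by (simp add: Finite_Cartesian_Product.vec_eq_iff algebra_simps)
  qed (simp add: la)
  \<comment> \<open>By the quadratic relation the inverse of \<open>t n\<close> has to be \<open>?c n - t n\<close>; with this choice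
    \<open>t n\<close> plus its inverse is a scalar and so commutes with everything.\<close>
  define T where "T = (\<lambda>g. case g of Gen n \<Rightarrow> t n | GenInv n \<Rightarrow> \<lambda>v. ?c n *s v - t n v)"
  have T [simp]: "T (Gen n) = t n" "T (GenInv n) = (\<lambda>v. ?c n *s v - t n v)" for n
    by (simp_all add: T_def)
  have linT: "Vector_Spaces.linear (*s) (*s) (T g)" for g
  proof (cases g)
    case (GenInv n)
    have "Vector_Spaces.linear (*s) (*s) (\<lambda>v. ?c n *s v - t n v)"
      unfolding Vector_Spaces.linear_iff la
      by (simp add: vec.vector_space_axioms Finite_Cartesian_Product.vec_eq_iff algebra_simps)
    then show ?thesis using GenInv by simp
  qed (simp add: lin)
  have invT: "T g v \<in> W" if "v \<in> W" for g v
    using that inv by (cases g) (auto intro!: vec.subspace_diff[OF sub] vec.subspace_scale[OF sub])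
  note mult = alg_op_mult[where T = T, OF linT]
  have central: "alg_op T (fgen (Gen n) + fgen (GenInv n)) v = ?c n *s v" for n v
    by (simp add: alg_op_add)
  have rel: "alg_op T r v = 0" if "r \<in> H_relators qh" "v \<in> W" for r v
    using that(1) unfolding H_relators_def
  proof (elim UnE CollectE exE conjE singletonE)
    fix n assume "r = fgen (Gen n) * fgen (GenInv n) - 1"
    then show ?thesis using quad[OF that(2), of n]
      by (simp add: alg_op_minus mult vec.linear_diff[OF lin] la)
  next
    fix n assume "r = fgen (GenInv n) * fgen (Gen n) - 1"
    then show ?thesis using quad[OF that(2), of n] by (simp add: alg_op_minus mult)
  next
    fix n a
    assume "r = (fgen (Gen n) + fgen (GenInv n)) * a - a * (fgen (Gen n) + fgen (GenInv n))"
    then show ?thesis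
      using vec.linear_scale[OF linear_alg_op[where T = T, OF linT]]
      by (simp add: alg_op_minus mult central)
  next
    assume "r = fgen (Gen 0) * fgen (Gen 1) * fgen (Gen 2) * fgen (Gen 3) - fscalar (inverse qh)"
    then show ?thesis using prod[OF that(2)] by (simp add: alg_op_minus mult)
  qed
  obtain act where act: "module_structure (H_hat qh) (\<lambda>c. H_class qh (fscalar c)) W act"
    and actT: "\<And>a v. v \<in> W \<Longrightarrow> act (H_class qh a) v = alg_op T a v"
    using quotient_module_structure[where T = T and S = "H_relators qh", OF linT sub invT rel]
    unfolding H_hat_def H_class_def H_ideal_def by blast
  have "represents (T_matrix d qh ssh r1h r2h n) (act (H_gen qh n)) ws W" for n
    unfolding represents_def H_gen_def len
    using basis T_matrix_carrier[OF d] actT[OF wsW] t by simp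
  with act show ?thesis by blast
qed

section \<open>The basis of cells\<close>

lemma char_vec_basis:
  fixes S :: "nat \<Rightarrow> 'v::finite set"
  assumes ne: "\<And>j. j < n \<Longrightarrow> S j \<noteq> {}"
    and disj: "\<And>i j. i < n \<Longrightarrow> j < n \<Longrightarrow> i \<noteq> j \<Longrightarrow> S i \<inter> S j = {}"
  shows "distinct (map (\<lambda>j. char_vec (S j)) [0..<n])"
    and "vec.independent ((\<lambda>j. char_vec (S j)) ` {..<n})"
proof -
  have at: "char_vec (S i) $ y = (if i = j then 1 else 0)" if "i < n" "j < n" "y \<in> S j" for i j y
    using disj[OF that(1,2)] that(3) by (auto simp: char_vec_def)
  have inj: "inj_on (\<lambda>j. char_vec (S j)) {..<n}"
  proof (rule inj_onI)
    fix i j assume ij: "i \<in> {..<n}" "j \<in> {..<n}" "char_vec (S i) = char_vec (S j)"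
    obtain y where "y \<in> S j" using ne ij by auto
    then show "i = j" using at[of i j y] at[of j j y] ij by (auto split: if_splits)
  qed
  then show "distinct (map (\<lambda>j. char_vec (S j)) [0..<n])"
    by (simp add: distinct_map atLeast0LessThan)
  show "vec.independent ((\<lambda>j. char_vec (S j)) ` {..<n})"
  proof
    assume "vec.dependent ((\<lambda>j. char_vec (S j)) ` {..<n})"
    then obtain u where u: "\<exists>v\<in>(\<lambda>j. char_vec (S j)) ` {..<n}. u v \<noteq> 0"
      "(\<Sum>v\<in>(\<lambda>j. char_vec (S j)) ` {..<n}. u v *s v) = 0"
      by (auto simp: vec.dependent_finite)
    have "u (char_vec (S j)) = 0" if "j < n" for j
    proof -
      obtain y where y: "y \<in> S j" using ne \<open>j < n\<close> by auto
      have "0 = (\<Sum>i<n. u (char_vec (S i)) *s char_vec (S i)) $ y"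
        using u(2) by (simp add: sum.reindex[OF inj])
      also have "\<dots> = (\<Sum>i<n. if i = j then u (char_vec (S j)) else 0)"
        unfolding sum_component by (rule sum.cong) (use at[OF _ that y] in auto)
      finally show ?thesis using that by simp
    qed
    then show False using u(1) by auto
  qed
qed

lemma W_basis_conv:
  "W_basis adj d C x =
     map (\<lambda>j. char_vec (if even j then C_minus adj C x (j div 2) else C_plus adj C x (j div 2))) [0..<2 * d]"
  unfolding W_basis_def by (induction d) auto

lemma W_basis_ordered_basis:
  assumes "\<And>i. i < d \<Longrightarrow> C_minus adj C x i \<noteq> {}" "\<And>i. i < d \<Longrightarrow> C_plus adj C x i \<noteq> {}"
  shows "ordered_basis (W_basis adj d C x) (W_space adj d C x)"
proof -
  define S where "S = (\<lambda>j. if even j then C_minus adj C x (j div 2) else C_plus adj C x (j div 2))"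
  have mem: "set_gdist adj y C = j div 2 \<and> gdist adj x y = j div 2 + j mod 2" if "y \<in> S j" for y j
    using that by (auto simp: S_def C_minus_def C_plus_def clique_cell_def sphere_at_def
        even_iff_mod_2_eq_zero odd_iff_mod_2_eq_one split: if_splits)
  have "S i \<inter> S j = {}" if "i \<noteq> j" for i j
  proof (rule ccontr)
    assume "S i \<inter> S j \<noteq> {}"
    then obtain y where "y \<in> S i" "y \<in> S j" by auto
    then have "i div 2 = j div 2" "i mod 2 = j mod 2" using mem[of y i] mem[of y j] by auto
    then show False using that by (metis div_mod_decomp)
  qed
  moreover have "S j \<noteq> {}" if "j < 2 * d" for j
    using assms[of "j div 2"] that by (auto simp: S_def)
  ultimately have b: "distinct (W_basis adj d C x)" "vec.independent (set (W_basis adj d C x))"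
    using char_vec_basis[of "2 * d" S]
    by (auto simp: W_basis_conv S_def atLeast0LessThan)
  have "set (W_basis adj d C x) = (\<Union>i<d. {char_vec (C_minus adj C x i), char_vec (C_plus adj C x i)})"
    unfolding W_basis_def by auto
  then show ?thesis using b by (simp add: ordered_basis_def W_space_def)
qed

section \<open>The module structure on the span of the cells\<close>

theorem proposition11p10:
  fixes adj :: "'v::finite \<Rightarrow> 'v \<Rightarrow> bool"
    and d :: nat
    and E :: "nat \<Rightarrow> complex^'v^'v"
    and \<theta> :: "nat \<Rightarrow> real"
    and \<theta>s \<phi>1 \<phi>2 :: "nat \<Rightarrow> complex"
    and C :: "'v set"
    and x :: 'v
    and q h hs s ss r1 r2 qh sh ssh r1h r2h :: complex
  assumes "simple_connected_graph adj"
    and "distance_regular adj"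
    and "diam adj = d" and "d \<ge> 3"
    and "idempotent_ordering adj d E (\<lambda>i. of_real (\<theta> i))"
    and "q_polynomial d E"
    and "\<forall>i<d. \<theta> i > \<theta> (i + 1)"
    and "delsarte_clique adj (\<theta> d) C"
    and "x \<in> C"
    and "dual_adjacency_matrix E x = (\<Sum>i\<le>d. smult_matrix (\<theta>s i) (dual_idempotent adj x i))"
    and "leonard_system (primary_module adj x) d
           ((*v) (adjacency_matrix adj)) ((*v) (dual_adjacency_matrix E x))
           (\<lambda>i. (*v) (E i)) (\<lambda>i. (*v) (dual_idempotent adj x i))"
    and "parameter_array (primary_module adj x) d
           ((*v) (adjacency_matrix adj)) ((*v) (dual_adjacency_matrix E x))
           (\<lambda>i. (*v) (E i)) (\<lambda>i. (*v) (dual_idempotent adj x i))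
           (\<lambda>i. of_real (\<theta> i)) \<theta>s \<phi>1 \<phi>2"
    and "q \<noteq> 0" and "q^2 \<noteq> 1"
    and "q_racah d q h hs s ss r1 r2 (\<lambda>i. of_real (\<theta> i)) \<theta>s \<phi>1 \<phi>2"
    and "qh^2 = q" and "sh^2 = s" and "ssh^2 = ss" and "r1h^2 = r1" and "r2h^2 = r2"
    and "r1h * r2h = sh * ssh * qh ^ (d + 1)"
  shows "\<exists>act :: hsym free_algebra set \<Rightarrow> complex^'v \<Rightarrow> complex^'v.
           module_structure (H_hat qh) (\<lambda>c. H_class qh (fscalar c)) (W_space adj d C x) act \<and>
           (\<forall>n::4. represents (T_matrix d qh ssh r1h r2h n) (act (H_gen qh n))
                     (W_basis adj d C x) (W_space adj d C x))"
proof (rule T_matrix_module)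
  have d: "1 \<le> d" using assms(4) by simp
  note graph = assms(1-3) d assms(5,7,8,9)
  show "ordered_basis (W_basis adj d C x) (W_space adj d C x)"
    by (rule W_basis_ordered_basis) (rule C_minus_nonempty[OF graph], assumption,
        rule C_plus_nonempty[OF graph], assumption)
  show "length (W_basis adj d C x) = 2 * d" by (simp add: W_basis_conv)
  show "0 < d" using d by simp
  have "ss \<noteq> 0" "r1 \<noteq> 0" "r2 \<noteq> 0" and ss: "\<forall>i\<in>{2..2 * d}. ss * q ^ i \<noteq> 1"
    using assms(15) by (auto simp: q_racah_def)
  then show "qh \<noteq> 0" "ssh \<noteq> 0" "r1h \<noteq> 0" "r2h \<noteq> 0"
    using assms(13,16,18-20) by auto
  show "ssh\<^sup>2 * (qh\<^sup>2) ^ k \<noteq> 1" if "2 \<le> k" "k \<le> 2 * d" for k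
    using ss that assms(16,18) by auto
qed

end
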